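(* Let $G$ be a finite group and let $K\lhd G$ be a normal subgroup that is maximal among the normal subgroups of $G$ with nonabelian quotient (so $G/K$ is nonabelian). If $G/K$ is a $p$-group for some prime $p$, then $\mathcal{D}(G)$ is connected and $\pi_1(\mathcal{D}(G))$ is trivial. In particular, if $G$ is nonabelian and nilpotent, then $\pi_1(\mathcal{D}(G))$ is trivial.
   Context: For a finite group $G$, $\mathrm{Irr}(G)$ is the set of irreducible complex characters of $G$ and $\mathrm{cd}(G)=\{\chi(1) : \chi\in\mathrm{Irr}(G)\}$. The prime divisor simplicial complex $\mathcal{D}(G)$ is the abstract simplicial complex whose vertices are the primes dividing at least one element of $\mathrm{cd}(G)\setminus\{1\}$, in which a nonempty set $Q$ of such primes is a simplex iff some element of $\mathrm{cd}(G)$ is divisible by every element of $Q$. $\pi_1(\mathcal{D}(G))$ denotes the fundamental group of (the geometric realization of) $\mathcal{D}(G)$. *)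

theory Defs
  imports
    "HOL-Analysis.Homotopy"
    "HOL-Analysis.Function_Topology"
    "HOL-Algebra.Elementary_Groups"
    "HOL-Algebra.Solvable_Groups"
    "Jordan_Normal_Form.VS_Connect"
begin

section \<open>Complex characters of a group\<close>

definition GL :: "nat \<Rightarrow> complex mat monoid" where
  "GL n = units_of (ring_mat TYPE(complex) n ())"

definition representation :: "('a, 'b) monoid_scheme \<Rightarrow> nat \<Rightarrow> ('a \<Rightarrow> complex mat) \<Rightarrow> bool" where
  "representation G n \<rho> \<longleftrightarrow> \<rho> \<in> hom G (GL n)"

definition invariant_subspace ::
  "('a, 'b) monoid_scheme \<Rightarrow> nat \<Rightarrow> ('a \<Rightarrow> complex mat) \<Rightarrow> complex vec set \<Rightarrow> bool" where
  "invariant_subspace G n \<rho> W \<longleftrightarrow>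
     subspace class_ring W (module_vec TYPE(complex) n) \<and>
     (\<forall>g\<in>carrier G. \<forall>w\<in>W. \<rho> g *\<^sub>v w \<in> W)"

definition irreducible_representation ::
  "('a, 'b) monoid_scheme \<Rightarrow> nat \<Rightarrow> ('a \<Rightarrow> complex mat) \<Rightarrow> bool" where
  "irreducible_representation G n \<rho> \<longleftrightarrow>
     representation G n \<rho> \<and> n > 0 \<and>
     (\<forall>W. invariant_subspace G n \<rho> W \<longrightarrow> W = {0\<^sub>v n} \<or> W = carrier_vec n)"

definition mat_trace :: "complex mat \<Rightarrow> complex" where
  "mat_trace A = (\<Sum>i<dim_row A. A $$ (i, i))"

text \<open>Characters live on \<open>carrier G\<close>; \<open>restrict\<close> normalises them to \<open>undefined\<close> elsewhere, so
  that equality of characters is equality of functions on the group.\<close>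

definition character :: "('a, 'b) monoid_scheme \<Rightarrow> ('a \<Rightarrow> complex mat) \<Rightarrow> 'a \<Rightarrow> complex" where
  "character G \<rho> = restrict (\<lambda>g. mat_trace (\<rho> g)) (carrier G)"

definition Irr :: "('a, 'b) monoid_scheme \<Rightarrow> ('a \<Rightarrow> complex) set" where
  "Irr G = {character G \<rho> |n \<rho>. irreducible_representation G n \<rho>}"

text \<open>The values \<open>\<chi>(1)\<close> are complex numbers that happen to be natural numbers (the trace of an
  identity matrix); they are collected as naturals so that divisibility makes sense.\<close>

definition cd :: "('a, 'b) monoid_scheme \<Rightarrow> nat set" where
  "cd G = {d. \<exists>f\<in>Irr G. f \<one>\<^bsub>G\<^esub> = of_nat d}"


section \<open>The prime divisor complex\<close>

definition degree_primes :: "('a, 'b) monoid_scheme \<Rightarrow> nat set" where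
  "degree_primes G = {p. normalization_semidom_class.prime p \<and> (\<exists>d\<in>cd G - {1}. p dvd d)}"

definition prime_divisor_complex :: "('a, 'b) monoid_scheme \<Rightarrow> nat set set" where
  "prime_divisor_complex G =
     {Q. Q \<noteq> {} \<and> Q \<subseteq> degree_primes G \<and> (\<exists>d\<in>cd G. \<forall>q\<in>Q. q dvd d)}"

text \<open>Points of the geometric realization are given by their barycentric coordinates. As a subspace
  of a function space, the realization carries the product topology; for a complex with finitely
  many vertices, such as the prime divisor complex of a finite group, this is the usual topology.\<close>

definition geometric_realization :: "'v set set \<Rightarrow> ('v \<Rightarrow> real) set" where
  "geometric_realization \<Delta> =
     {x. (\<forall>v. 0 \<le> x v) \<and> {v. x v \<noteq> 0} \<in> \<Delta> \<and> (\<Sum>v | x v \<noteq> 0. x v) = 1}"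


section \<open>The fundamental group\<close>

definition based_loops :: "'a::topological_space set \<Rightarrow> 'a \<Rightarrow> (real \<Rightarrow> 'a) set" where
  "based_loops S x =
     {p. path p \<and> path_image p \<subseteq> S \<and> pathstart p = x \<and> pathfinish p = x}"

definition loop_rel :: "'a::topological_space set \<Rightarrow> 'a \<Rightarrow> ((real \<Rightarrow> 'a) \<times> (real \<Rightarrow> 'a)) set" where
  "loop_rel S x = {(p, q). p \<in> based_loops S x \<and> q \<in> based_loops S x \<and> homotopic_paths S p q}"

definition fundamental_group :: "'a::topological_space set \<Rightarrow> 'a \<Rightarrow> (real \<Rightarrow> 'a) set monoid" where
  "fundamental_group S x = \<lparr>
     carrier = based_loops S x // loop_rel S x,
     mult = (\<lambda>A B. \<Union>p\<in>A. \<Union>q\<in>B. loop_rel S x `` {p +++ q}),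
     one = loop_rel S x `` {\<lambda>_. x}\<rparr>"

text \<open>Triviality is required at every base point. A fundamental group presupposes a base point, so
  the empty space is excluded.\<close>

definition trivial_fundamental_group :: "'a::topological_space set \<Rightarrow> bool" where
  "trivial_fundamental_group S \<longleftrightarrow>
     S \<noteq> {} \<and> (\<forall>x\<in>S. trivial_group (fundamental_group S x))"

lemma equiv_loop_rel: "equiv (based_loops S x) (loop_rel S x)"
proof (rule equivI)
  show "refl_on (based_loops S x) (loop_rel S x)"
    by (auto simp: refl_on_def loop_rel_def based_loops_def)
  show "sym (loop_rel S x)"
    unfolding sym_def loop_rel_def using homotopic_paths_sym by blast
  show "trans (loop_rel S x)"
    unfolding trans_def loop_rel_def using homotopic_paths_trans by blast
qed (auto simp: loop_rel_def)

lemma fundamental_group_mult_class: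
  assumes p: "p \<in> based_loops S x" and q: "q \<in> based_loops S x"
  shows "mult (fundamental_group S x) (loop_rel S x `` {p}) (loop_rel S x `` {q})
         = loop_rel S x `` {p +++ q}"
proof -
  have *: "loop_rel S x `` {p' +++ q'} = loop_rel S x `` {p +++ q}"
    if p': "p' \<in> loop_rel S x `` {p}" and q': "q' \<in> loop_rel S x `` {q}" for p' q'
  proof (rule equiv_class_eq[OF equiv_loop_rel])
    have l: "p' \<in> based_loops S x" "q' \<in> based_loops S x"
      and h: "homotopic_paths S p' p" "homotopic_paths S q' q"
      using p' q' homotopic_paths_sym unfolding loop_rel_def by blast+
    have "p' +++ q' \<in> based_loops S x" "p +++ q \<in> based_loops S x"
      using p q l by (simp_all add: based_loops_def path_image_join)
    moreover have "homotopic_paths S (p' +++ q') (p +++ q)"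
      using h l by (intro homotopic_paths_join) (simp_all add: based_loops_def)
    ultimately show "(p' +++ q', p +++ q) \<in> loop_rel S x"
      by (simp add: loop_rel_def)
  qed
  have "p \<in> loop_rel S x `` {p}" "q \<in> loop_rel S x `` {q}"
    using p q by (simp_all add: loop_rel_def based_loops_def)
  then have "(\<Union>p'\<in>loop_rel S x `` {p}. \<Union>q'\<in>loop_rel S x `` {q}. loop_rel S x `` {p' +++ q'})
             = loop_rel S x `` {p +++ q}"
    using * by blast
  then show ?thesis
    by (simp add: fundamental_group_def)
qed


section \<open>Group-theoretic notions\<close>

definition p_group :: "nat \<Rightarrow> ('a, 'b) monoid_scheme \<Rightarrow> bool" where
  "p_group p G \<longleftrightarrow> group G \<and> (\<exists>k. Coset.order G = p ^ k)"

definition maximal_nonabelian_quotient :: "('a, 'b) monoid_scheme \<Rightarrow> 'a set \<Rightarrow> bool" where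
  "maximal_nonabelian_quotient G K \<longleftrightarrow>
     K \<lhd> G \<and> \<not> comm_group (G Mod K) \<and>
     (\<forall>N. N \<lhd> G \<and> \<not> comm_group (G Mod N) \<and> K \<subseteq> N \<longrightarrow> N = K)"

primrec lower_central_series :: "('a, 'b) monoid_scheme \<Rightarrow> nat \<Rightarrow> 'a set" where
  "lower_central_series G 0 = carrier G"
| "lower_central_series G (Suc n) = generate G
     (\<Union>h\<in>lower_central_series G n. \<Union>k\<in>carrier G.
        {h \<otimes>\<^bsub>G\<^esub> k \<otimes>\<^bsub>G\<^esub> inv\<^bsub>G\<^esub> h \<otimes>\<^bsub>G\<^esub> inv\<^bsub>G\<^esub> k})"

definition nilpotent_group :: "('a, 'b) monoid_scheme \<Rightarrow> bool" where
  "nilpotent_group G \<longleftrightarrow> group G \<and> (\<exists>n. lower_central_series G n = {\<one>\<^bsub>G\<^esub>})"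

end

theory Submission
  imports
    Defs
    "HOL-Algebra.Group_Action"
    "HOL-Algebra.Multiplicative_Group"
    "HOL-Algebra.Sylow"
    "Jordan_Normal_Form.Spectral_Radius"
begin

text \<open>
  The reason behind the theorem is that \<open>D(G)\<close> is a cone with apex \<open>p\<close>. A cone is contractible
  (\<open>cone_realization\<close>), and contractible spaces are connected with trivial fundamental group.
  Being a cone means that every degree \<open>d\<close> divides a degree that is also divisible by \<open>p\<close>
  (\<open>degree_multiple_of_prime\<close>). This has to be shown only if \<open>p\<close> does not divide \<open>d\<close>, and then
  \<open>d * f\<close> is a degree, where \<open>f\<close> is the degree of an irreducible representation of \<open>G/K\<close> and \<open>p\<close>
  divides \<open>f\<close>.

  On the side of groups, \<open>G/K\<close> has a nontrivial centre, being a nontrivial \<open>p\<close>-group. Let \<open>Z\<close> be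
  its preimage in \<open>G\<close>. By the maximality of \<open>K\<close> the group \<open>G/Z\<close> is abelian. So \<open>G/K\<close> has class two:
  every proper subgroup of \<open>G\<close> containing \<open>K\<close> is strictly smaller than its normalizer, and there are
  commutators outside \<open>K\<close>, all of them central modulo \<open>K\<close>.

  On the side of representations, irreducibility is always tested by Schur's criterion: a
  representation of a finite group is irreducible iff only scalar matrices commute with it
  (\<open>schur\<close>, \<open>irreducibleI\<close>). Three results carry the proof.

  \<^item> \<open>scalar_commutant_restrict\<close>: an irreducible \<open>\<rho>\<close> of degree prime to \<open>p\<close> stays irreducible on \<open>K\<close>.
    One climbs down from \<open>G\<close> to \<open>K\<close>, from a subgroup to a smaller one that it normalizes. If the
    commutant grew in such a step, the conjugation by \<open>\<rho>(g)\<close>, which has \<open>p\<close>-power order on the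
    commutant, would have an eigenvector \<open>F\<close> with an eigenvalue \<open>\<zeta> \<noteq> 1\<close>. The kernel of \<open>F\<close> is
    invariant, so \<open>F\<close> is invertible, and determinants in \<open>\<rho>(g) F \<rho>(g)\<inverse> = \<zeta> F\<close> give
    \<open>\<zeta> ^ d = 1\<close>, which is impossible for a \<open>p\<close>-power root of unity \<open>\<zeta> \<noteq> 1\<close>.

  \<^item> \<open>kronecker_irreducible\<close> (Gallagher): if \<open>\<rho>\<close> is irreducible on \<open>K\<close> and \<open>\<psi>\<close> is an irreducible
    representation of \<open>G/K\<close>, then \<open>\<rho> \<otimes> \<psi>\<close> is irreducible.

  \<^item> \<open>commutator_scalar_irreducible\<close>: a commutator \<open>c\<close> that is central modulo \<open>K\<close> but not in \<open>K\<close> acts in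
    some irreducible representation of \<open>G/K\<close> as a scalar \<open>\<zeta> \<noteq> 1\<close>. As \<open>c\<close> is a commutator its
    determinant \<open>\<zeta> ^ f\<close> is \<open>1\<close>, and \<open>\<zeta>\<close> is a \<open>p\<close>-power root of unity, so \<open>p\<close> divides the degree \<open>f\<close>.

  If \<open>G\<close> is nilpotent, the lower central series provides the nontrivial centre of \<open>G/K\<close>, and a
  finite nonabelian group with nontrivial centre and only abelian proper quotients is a \<open>p\<close>-group
  (\<open>minimal_nonabelian_quotient_p_group\<close>). So the first part applies.
\<close>


section \<open>Cones are contractible\<close>

text \<open>  A contraction \<open>H\<close> moves the base point along \<open>c(t) = H(t, x)\<close>, so it is not a homotopy of based loops.
  The map \<open>F(t, s) = H(t, p(s))\<close> on the unit square repairs this: the side \<open>t = 0\<close> is homotopic in the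
  convex square to the way around the other three sides, and along those \<open>F\<close> only runs through \<open>c\<close>
  forth and back.\<close>

lemma loop_null_of_contraction:
  fixes S :: "'a::topological_space set" and H :: "real \<times> 'a \<Rightarrow> 'a"
  assumes H: "continuous_on ({0..1} \<times> S) H" "H \<in> {0..1} \<times> S \<rightarrow> S"
    and H0: "\<And>x. x \<in> S \<Longrightarrow> H (0, x) = x" and H1: "\<And>x. x \<in> S \<Longrightarrow> H (1, x) = e"
    and p: "path p" "path_image p \<subseteq> S" "pathstart p = x" "pathfinish p = x"
  shows "homotopic_paths S p (\<lambda>_. x)"
proof -
  let ?sq = "{0..1::real} \<times> {0..1::real}"
  define b where "b = linepath (0::real, 0::real) (0, 1)"
  define q where "q = linepath (0::real, 0::real) (1, 0) +++ linepath (1, 0) (1, 1) +++ linepath (1, 1) (0, 1)"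
  define F where "F = (\<lambda>(t, s). H (t, p s))"
  define c where "c = (\<lambda>t. H (t, x))"
  have p01: "p s \<in> S" if "s \<in> {0..1}" for s
    using p(2) that by (auto simp: path_image_def)
  have xS: "x \<in> S"
    using p01[of 0] p(3) by (simp add: pathstart_def)
  have contF: "continuous_on ?sq F"
    unfolding F_def split_def
  proof (rule continuous_on_compose2[OF H(1)])
    have "continuous_on ?sq (\<lambda>z. p (snd z))"
      by (rule continuous_on_compose2[OF p(1)[unfolded path_def] continuous_on_snd[OF continuous_on_id]]) auto
    then show "continuous_on ?sq (\<lambda>z. (fst z, p (snd z)))"
      by (intro continuous_intros)
  qed (use p01 in auto)
  have FS: "F \<in> ?sq \<rightarrow> S"
    using H(2) p01 by (auto simp: F_def)
  have contc: "continuous_on {0..1} c"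
    unfolding c_def by (rule continuous_on_compose2[OF H(1)]) (use xS in \<open>auto intro!: continuous_intros\<close>)
  have cS: "c \<in> {0..1} \<rightarrow> S"
    using H(2) xS by (auto simp: c_def)
  have cvx: "convex ?sq"
    by (intro convex_Times) auto
  have seg: "closed_segment u v \<subseteq> ?sq" if "u \<in> ?sq" "v \<in> ?sq" for u v
    using closed_segment_subset[OF that cvx] .
  have pq: "path q" "pathstart q = (0, 0)" "pathfinish q = (0, 1)"
    by (simp_all add: q_def)
  have piq: "path_image q \<subseteq> closed_segment (0, 0) (1, 0) \<union> closed_segment (1, 0) (1, 1) \<union> closed_segment (1, 1) (0, 1)"
    by (auto simp: q_def path_image_join)
  have qsq: "path_image q \<subseteq> ?sq"
    using piq seg[of "(0,0)" "(1,0)"] seg[of "(1,0)" "(1,1)"] seg[of "(1,1)" "(0,1)"] by auto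
  have q01: "q s \<in> path_image q" if "s \<in> {0..1}" for s
    using that by (auto simp: path_image_def)
  \<comment> \<open>On the sides \<open>s = 0\<close> and \<open>s = 1\<close> the loop is at \<open>x\<close>; on the side \<open>t = 1\<close> everything is at the tip \<open>e = c(1)\<close>.\<close>
  have Fq: "F (q s) = c (fst (q s))" if s: "s \<in> {0..1}" for s
  proof -
    obtain u v where uv: "q s = (u, v)" by (cases "q s")
    have "v = 0 \<or> u = 1 \<or> v = 1"
      using piq q01[OF s] uv by (auto simp: in_segment)
    then show ?thesis
      using p(3,4) q01[OF s] qsq p01[of v] xS H1 uv
      by (auto simp: F_def c_def pathstart_def pathfinish_def)
  qed
  have "homotopic_paths ?sq b q"
  proof (rule homotopic_paths_linear)
    show "closed_segment (b t) (q t) \<subseteq> ?sq" if "t \<in> {0..1}" for t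
      using that q01[OF that] qsq by (intro seg) (auto simp: b_def linepath_def)
  qed (simp_all add: b_def pq)
  then have bq: "homotopic_paths S (F \<circ> b) (F \<circ> q)"
    using contF FS by (rule homotopic_paths_continuous_image)
  have "homotopic_paths S p (F \<circ> b)"
    using p p01 H0 by (intro homotopic_paths_eq) (auto simp: F_def b_def linepath_def)
  also note bq
  also have "homotopic_paths S (F \<circ> q) (c \<circ> (fst \<circ> q))"
    using homotopic_paths_imp_path[OF bq] homotopic_paths_imp_subset[OF bq] Fq
    by (intro homotopic_paths_eq) auto
  \<comment> \<open>The first coordinate of \<open>q\<close> is a loop at \<open>0\<close> in the interval, hence null-homotopic there.\<close>
  also have "homotopic_paths S (c \<circ> (fst \<circ> q)) (c \<circ> linepath 0 0)"
  proof (rule homotopic_paths_continuous_image[OF _ contc cS], rule homotopic_paths_linear)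
    show "path (fst \<circ> q)"
      using pq(1) by (intro path_continuous_image continuous_intros)
    show "closed_segment ((fst \<circ> q) t) (linepath 0 0 t) \<subseteq> {0..1}" if "t \<in> {0..1}" for t
      using q01[OF that] qsq by (intro closed_segment_subset) (auto simp: linepath_def)
  qed (use pq in \<open>auto simp: pathstart_def pathfinish_def\<close>)
  also have "c \<circ> linepath 0 0 = (\<lambda>_. x)"
    using H0[OF xS] by (auto simp: c_def linepath_def)
  finally show ?thesis .
qed

lemma trivial_fundamental_groupI:
  assumes "S \<noteq> {}"
    and null: "\<And>x p. p \<in> based_loops S x \<Longrightarrow> homotopic_paths S p (\<lambda>_. x)"
  shows "trivial_fundamental_group S"
  unfolding trivial_fundamental_group_def
proof (intro conjI ballI)
  fix x assume x: "x \<in> S"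
  let ?G = "fundamental_group S x"
  let ?e = "loop_rel S x `` {\<lambda>_. x}"
  have const: "(\<lambda>_. x) \<in> based_loops S x"
    using x by (auto simp: based_loops_def path_def pathstart_def pathfinish_def path_image_def)
  have cls: "loop_rel S x `` {p} = ?e" if "p \<in> based_loops S x" for p
  proof (rule equiv_class_eq[OF equiv_loop_rel])
    show "(p, \<lambda>_. x) \<in> loop_rel S x"
      using null[OF that] that const by (simp add: loop_rel_def)
  qed
  have car: "carrier ?G = {?e}"
    unfolding fundamental_group_def partial_object.simps quotient_def using const cls by blast
  have one: "\<one>\<^bsub>?G\<^esub> = ?e"
    by (simp add: fundamental_group_def)
  have "(\<lambda>_. x) +++ (\<lambda>_. x) = (\<lambda>_. x)"
    by (auto simp: joinpaths_def)
  then have mult: "?e \<otimes>\<^bsub>?G\<^esub> ?e = ?e"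
    using fundamental_group_mult_class[OF const const] by simp
  have "group ?G"
    by (rule groupI) (simp_all only: car one mult singleton_iff ball_simps bex_simps simp_thms insertI1)
  then show "trivial_group ?G"
    by (simp add: trivial_group_def car one)
qed (fact assms(1))

lemma contractible_imp_trivial_fundamental_group:
  fixes S :: "'a::topological_space set" and H :: "real \<times> 'a \<Rightarrow> 'a"
  assumes "S \<noteq> {}" and H: "continuous_on ({0..1} \<times> S) H" "H \<in> {0..1} \<times> S \<rightarrow> S"
    and H0: "\<And>x. x \<in> S \<Longrightarrow> H (0, x) = x" and H1: "\<And>x. x \<in> S \<Longrightarrow> H (1, x) = e"
  shows "connected S" and "trivial_fundamental_group S"
proof -
  show "trivial_fundamental_group S"
    using loop_null_of_contraction[OF H H0 H1] assms(1)
    by (intro trivial_fundamental_groupI) (auto simp: based_loops_def)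
  have "path_component S x e" if x: "x \<in> S" for x
    unfolding path_component_def
  proof (intro exI conjI)
    let ?g = "\<lambda>t. H (t, x)"
    have "continuous_on {0..1} ?g"
      by (rule continuous_on_compose2[OF H(1)]) (use x in \<open>auto intro!: continuous_intros\<close>)
    then show "path ?g" by (simp add: path_def)
    show "path_image ?g \<subseteq> S" using H(2) x by (auto simp: path_image_def)
  qed (use x H0 H1 in \<open>auto simp: pathstart_def pathfinish_def\<close>)
  then have "path_connected S"
    unfolding path_connected_component by (metis path_component_sym path_component_trans)
  then show "connected S" by (rule path_connected_imp_connected)
qed

text \<open>  The straight line from \<open>x\<close> to the apex \<open>a\<close> stays in the realization because its inner points have
  support \<open>insert a (supp x)\<close>.\<close>

lemma cone_realization:
  fixes \<Delta> :: "'v set set"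
  assumes apex: "{a} \<in> \<Delta>" and cone: "\<And>Q. Q \<in> \<Delta> \<Longrightarrow> insert a Q \<in> \<Delta>"
  shows "connected (geometric_realization \<Delta>)"
    and "trivial_fundamental_group (geometric_realization \<Delta>)"
proof -
  let ?S = "geometric_realization \<Delta>"
  define e where "e = (\<lambda>v. if v = a then 1 else 0 :: real)"
  define H where "H = (\<lambda>(t::real, x) v. (1 - t) * x v + t * e v :: real)"
  have supp_e: "{v. e v \<noteq> 0} = {a}" by (auto simp: e_def)
  have ne: "?S \<noteq> {}"
  proof -
    have "e \<in> ?S" using apex by (simp add: geometric_realization_def supp_e) (simp add: e_def)
    then show ?thesis by blast
  qed
  have HS: "H (t, x) \<in> ?S" if t: "t \<in> {0..1}" and x: "x \<in> ?S" for t x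
  proof -
    let ?A = "{v. x v \<noteq> 0}"
    have x0: "\<And>v. 0 \<le> x v" and A: "?A \<in> \<Delta>" and s: "(\<Sum>v\<in>?A. x v) = 1"
      using x by (auto simp: geometric_realization_def)
    have fin: "finite ?A" using s by (metis sum.infinite zero_neq_one)
    have H0: "0 \<le> H (t, x) v" for v
      using t x0 by (auto simp: H_def e_def)
    have supp: "{v. H (t, x) v \<noteq> 0} = (if t = 0 then ?A else if t = 1 then {a} else insert a ?A)"
    proof -
      have "H (t, x) v \<noteq> 0 \<longleftrightarrow> (t \<noteq> 1 \<and> x v \<noteq> 0) \<or> (t \<noteq> 0 \<and> v = a)" for v
        using t x0[of v] by (auto simp: H_def e_def add_nonneg_eq_0_iff)
      then show ?thesis by auto
    qed
    have "(\<Sum>v | H (t, x) v \<noteq> 0. H (t, x) v) = (\<Sum>v\<in>insert a ?A. H (t, x) v)"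
      by (rule sum.mono_neutral_left) (use fin supp in \<open>auto split: if_splits\<close>)
    also have "\<dots> = (1 - t) * (\<Sum>v\<in>insert a ?A. x v) + t * (\<Sum>v\<in>insert a ?A. e v)"
      by (simp only: H_def prod.case sum.distrib sum_distrib_left)
    also have "(\<Sum>v\<in>insert a ?A. x v) = 1"
      unfolding s[symmetric] by (rule sum.mono_neutral_right) (use fin in auto)
    also have "(\<Sum>v\<in>insert a ?A. e v) = 1"
      using fin by (simp add: e_def)
    finally have "(\<Sum>v | H (t, x) v \<noteq> 0. H (t, x) v) = 1" by simp
    moreover have "{v. H (t, x) v \<noteq> 0} \<in> \<Delta>"
      using A apex cone by (simp add: supp)
    ultimately show ?thesis using H0 by (simp add: geometric_realization_def)
  qed
  have cont: "continuous_on ({0..1} \<times> ?S) H"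
  proof (rule continuous_on_coordinatewise_then_product)
    fix v
    have "continuous_on ({0..1} \<times> ?S) (\<lambda>z. (1 - fst z) * snd z v + fst z * e v)"
      by (intro continuous_intros continuous_on_product_then_coordinatewise)
    then show "continuous_on ({0..1} \<times> ?S) (\<lambda>z. H z v)"
      by (simp add: H_def split_def)
  qed
  have HS': "H \<in> {0..1} \<times> ?S \<rightarrow> ?S"
    using HS by (intro Pi_I) (simp only: mem_Times_iff split_paired_all fst_conv snd_conv)
  have H0: "H (0, x) = x" and H1: "H (1, x) = e" for x
    by (simp_all add: H_def fun_eq_iff)
  have "connected ?S \<and> trivial_fundamental_group ?S"
    using contractible_imp_trivial_fundamental_group[OF ne cont HS' H0 H1] by blast
  then show "connected ?S" "trivial_fundamental_group ?S" by auto
qed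


section \<open>Commutators and centres\<close>

definition commutator :: "('a, 'b) monoid_scheme \<Rightarrow> 'a \<Rightarrow> 'a \<Rightarrow> 'a" where
  "commutator G x y = x \<otimes>\<^bsub>G\<^esub> y \<otimes>\<^bsub>G\<^esub> inv\<^bsub>G\<^esub> x \<otimes>\<^bsub>G\<^esub> inv\<^bsub>G\<^esub> y"

lemma (in group) commutator_closed [simp]:
  "x \<in> carrier G \<Longrightarrow> y \<in> carrier G \<Longrightarrow> commutator G x y \<in> carrier G"
  by (simp add: commutator_def)

lemma (in group) commutator_mult:
  assumes "x \<in> carrier G" "y \<in> carrier G"
  shows "commutator G x y \<otimes> (y \<otimes> x) = x \<otimes> y"
  using assms by (simp add: commutator_def m_assoc) (simp flip: m_assoc)

lemma (in group) commutator_eq_one_iff: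
  assumes "x \<in> carrier G" "y \<in> carrier G"
  shows "commutator G x y = \<one> \<longleftrightarrow> x \<otimes> y = y \<otimes> x"
  using commutator_mult[OF assms] assms by (metis l_one m_closed commutator_closed r_cancel_one')

lemma (in group) comm_group_iff_commutators:
  "comm_group G \<longleftrightarrow> (\<forall>x\<in>carrier G. \<forall>y\<in>carrier G. commutator G x y = \<one>)"
  using commutator_eq_one_iff comm_groupE(4) group_comm_groupI by metis

lemma (in normal) coset_eq_H_iff: "x \<in> carrier G \<Longrightarrow> H #> x = H \<longleftrightarrow> x \<in> H"
  using coset_join1 coset_join2 is_subgroup by (metis rcos_self subgroup_axioms)

lemma (in normal) coset_commutator:
  assumes "x \<in> carrier G" "y \<in> carrier G"
  shows "commutator (G Mod H) (H #> x) (H #> y) = H #> commutator G x y"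
  using assms by (simp add: commutator_def inv_FactGroup carrier_FactGroup rcos_inv rcos_sum)

lemma (in normal) comm_group_Mod_iff:
  "comm_group (G Mod H) \<longleftrightarrow> (\<forall>x\<in>carrier G. \<forall>y\<in>carrier G. commutator G x y \<in> H)"
  using group.comm_group_iff_commutators[OF factorgroup_is_group]
  by (simp add: carrier_FactGroup coset_commutator coset_eq_H_iff)

definition group_center :: "('a, 'b) monoid_scheme \<Rightarrow> 'a set" where
  "group_center G = {z \<in> carrier G. \<forall>g\<in>carrier G. z \<otimes>\<^bsub>G\<^esub> g = g \<otimes>\<^bsub>G\<^esub> z}"

lemma (in group) group_center_normal: "group_center G \<lhd> G"
  unfolding normal_inv_iff
proof (intro conjI ballI subgroupI)
  show "group_center G \<noteq> {}" by (auto simp: group_center_def intro!: exI[of _ \<one>])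
  show "inv a \<in> group_center G" if "a \<in> group_center G" for a
  proof -
    have ac: "a \<in> carrier G" using that by (simp add: group_center_def)
    have "inv a \<otimes> g = g \<otimes> inv a" if g: "g \<in> carrier G" for g
    proof -
      have ag: "a \<otimes> g = g \<otimes> a" using \<open>a \<in> group_center G\<close> g by (simp add: group_center_def)
      have "inv a \<otimes> g = inv a \<otimes> ((g \<otimes> a) \<otimes> inv a)" using ac g by (simp add: m_assoc)
      also have "\<dots> = (inv a \<otimes> (a \<otimes> g)) \<otimes> inv a" unfolding ag using ac g by (simp add: m_assoc)
      also have "inv a \<otimes> (a \<otimes> g) = g" using ac g by (simp flip: m_assoc)
      finally show ?thesis .
    qed
    then show ?thesis using ac unfolding group_center_def by blast
  qed
  show "a \<otimes> b \<in> group_center G" if "a \<in> group_center G" "b \<in> group_center G" for a b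
  proof -
    have ab: "a \<in> carrier G" "b \<in> carrier G" using that by (simp_all add: group_center_def)
    have "a \<otimes> b \<otimes> g = g \<otimes> (a \<otimes> b)" if g: "g \<in> carrier G" for g
    proof -
      have ag: "a \<otimes> g = g \<otimes> a" and bg: "b \<otimes> g = g \<otimes> b"
        using \<open>a \<in> group_center G\<close> \<open>b \<in> group_center G\<close> g by (simp_all add: group_center_def)
      have "a \<otimes> b \<otimes> g = a \<otimes> g \<otimes> b" using ab g bg by (simp add: m_assoc)
      then show ?thesis using ab g ag by (simp add: m_assoc)
    qed
    then show ?thesis using ab unfolding group_center_def by blast
  qed
  show "x \<otimes> h \<otimes> inv x \<in> group_center G" if x: "x \<in> carrier G" and h: "h \<in> group_center G" for x h
  proof -
    have "h \<otimes> x = x \<otimes> h" "h \<in> carrier G" using x h by (simp_all add: group_center_def)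
    then have "x \<otimes> h \<otimes> inv x = h" using x by (metis inv_solve_right m_closed)
    then show ?thesis using h by simp
  qed
qed (auto simp: group_center_def)

text \<open>  The preimage in \<open>G\<close> of the centre of \<open>G/K\<close>, expressed by commutators so that it can be used
  without passing to cosets.\<close>

definition center_mod :: "('a, 'b) monoid_scheme \<Rightarrow> 'a set \<Rightarrow> 'a set" where
  "center_mod G K = {z \<in> carrier G. \<forall>g\<in>carrier G. commutator G z g \<in> K}"

lemma (in normal) center_mod_iff:
  "z \<in> carrier G \<Longrightarrow> z \<in> center_mod G H \<longleftrightarrow> H #> z \<in> group_center (G Mod H)"
proof -
  assume z: "z \<in> carrier G"
  interpret Q: group "G Mod H" by (rule factorgroup_is_group)
  have coset: "H #> g \<in> carrier (G Mod H)" if "g \<in> carrier G" for g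
    using that by (simp add: carrier_FactGroup)
  have "commutator G z g \<in> H \<longleftrightarrow> (H #> z) \<otimes>\<^bsub>G Mod H\<^esub> (H #> g) = (H #> g) \<otimes>\<^bsub>G Mod H\<^esub> (H #> z)"
    if g: "g \<in> carrier G" for g
    using Q.commutator_eq_one_iff[OF coset[OF z] coset[OF g]] coset_commutator[OF z g]
      coset_eq_H_iff[OF commutator_closed[OF z g]] by simp
  then show ?thesis using z coset[OF z] by (auto simp: center_mod_def group_center_def carrier_FactGroup)
qed

text \<open>  This transports the statements about normal subgroups of \<open>G/K\<close> to normal subgroups of \<open>G\<close>
  that contain \<open>K\<close>, to which the maximality of \<open>K\<close> refers.\<close>

lemma (in normal) preimage_normal:
  assumes N: "N \<lhd> G Mod H"
  shows "{g \<in> carrier G. H #> g \<in> N} \<lhd> G"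
proof -
  interpret N: normal N "G Mod H" by (rule N)
  have coset: "H #> g \<in> carrier (G Mod H)" if "g \<in> carrier G" for g
    using that by (simp add: carrier_FactGroup)
  have inv: "H #> inv g = inv\<^bsub>G Mod H\<^esub> (H #> g)" if "g \<in> carrier G" for g
    using that coset[OF that] by (simp add: inv_FactGroup rcos_inv)
  have mult: "H #> (g \<otimes> h) = (H #> g) \<otimes>\<^bsub>G Mod H\<^esub> (H #> h)" if "g \<in> carrier G" "h \<in> carrier G" for g h
    using that by (simp add: rcos_sum)
  show ?thesis
    unfolding normal_inv_iff
  proof (intro conjI ballI subgroupI)
    have "\<one> \<in> {g \<in> carrier G. H #> g \<in> N}"
      using subgroup.one_closed[OF N.subgroup_axioms] by (simp add: coset_eq_H_iff[THEN iffD2, OF one_closed subgroup.one_closed[OF subgroup_axioms]])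
    then show "{g \<in> carrier G. H #> g \<in> N} \<noteq> {}" by blast
  next
    fix g assume "g \<in> {g \<in> carrier G. H #> g \<in> N}"
    then show "inv g \<in> {g \<in> carrier G. H #> g \<in> N}" using inv subgroup.m_inv_closed[OF N.subgroup_axioms] by simp
  next
    fix g h assume "g \<in> {g \<in> carrier G. H #> g \<in> N}" "h \<in> {g \<in> carrier G. H #> g \<in> N}"
    then show "g \<otimes> h \<in> {g \<in> carrier G. H #> g \<in> N}"
      using subgroup.m_closed[OF N.subgroup_axioms] mult by (simp del: mult_FactGroup)
  next
    fix x h assume x: "x \<in> carrier G" and h: "h \<in> {g \<in> carrier G. H #> g \<in> N}"
    then have "(H #> x) \<otimes>\<^bsub>G Mod H\<^esub> (H #> h) \<otimes>\<^bsub>G Mod H\<^esub> inv\<^bsub>G Mod H\<^esub> (H #> x) \<in> N"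
      using N.inv_op_closed2[OF coset[OF x]] by simp
    then show "x \<otimes> h \<otimes> inv x \<in> {g \<in> carrier G. H #> g \<in> N}"
      using x h mult inv by (simp del: mult_FactGroup)
  qed auto
qed

lemma (in normal) center_mod_normal: "center_mod G H \<lhd> G"
proof -
  have "center_mod G H = {g \<in> carrier G. H #> g \<in> group_center (G Mod H)}"
    using center_mod_iff by (auto simp: center_mod_def)
  then show ?thesis using preimage_normal[OF group.group_center_normal[OF factorgroup_is_group]] by simp
qed

lemma (in normal) subset_center_mod: "H \<subseteq> center_mod G H"
proof
  fix k assume k: "k \<in> H"
  interpret Q: group "G Mod H" by (rule factorgroup_is_group)
  have "H #> k = \<one>\<^bsub>G Mod H\<^esub>" using k by (simp add: coset_eq_H_iff)
  then have "H #> k \<in> group_center (G Mod H)"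
    using subgroup.one_closed[OF normal_imp_subgroup[OF Q.group_center_normal]] by simp
  then show "k \<in> center_mod G H" using center_mod_iff[OF mem_carrier[OF k]] by simp
qed

text \<open>  The class equation: the conjugacy classes have \<open>p\<close>-power size, and those of size one are the central
  elements. If \<open>\<one>\<close> were the only central element, all other classes would have size divisible by \<open>p\<close>
  and the group order would be \<open>1\<close> modulo \<open>p\<close>.\<close>

lemma (in group) p_group_center_nontrivial:
  assumes p: "normalization_semidom_class.prime (p::nat)" and ord: "Coset.order G = p ^ k" and nt: "carrier G \<noteq> {\<one>}"
  shows "\<exists>z\<in>group_center G. z \<noteq> \<one>"
proof (rule ccontr)
  assume no: "\<not> ?thesis"
  let ?\<phi> = "\<lambda>g. \<lambda>h\<in>carrier G. g \<otimes> h \<otimes> inv g"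
  interpret act: group_action G "carrier G" ?\<phi> by (rule action_by_conjugation)
  have "Coset.order G > 0" using ord p by (simp add: prime_gt_0_nat)
  then have fin: "finite (carrier G)" using order_gt_0_iff_finite by simp
  have dvd: "p dvd card Q" if Q: "Q \<in> orbits G (carrier G) ?\<phi>" "Q \<noteq> {\<one>}" for Q
  proof -
    obtain x where x: "x \<in> carrier G" and Ox: "Q = orbit G ?\<phi> x" using Q(1) unfolding orbits_def by blast
    have "card Q dvd p ^ k" using act.orbit_stabilizer_theorem[OF x] unfolding ord Ox[symmetric] by (rule dvdI[OF sym])
    moreover have "card Q \<noteq> 1"
    proof
      assume "card Q = 1"
      moreover have "x \<in> Q" using act.orbit_refl[OF x] by (simp add: Ox)
      ultimately have Osing: "Q = {x}" by (auto simp: card_Suc_eq One_nat_def)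
      have "g \<otimes> x \<otimes> inv g = x" if g: "g \<in> carrier G" for g
      proof -
        have "?\<phi> g x \<in> Q" unfolding Ox orbit_def by (rule CollectI, rule exI[of _ g]) (use g in simp)
        then have "g \<otimes> x \<otimes> inv g \<in> Q" using x by simp
        then show ?thesis using Osing by simp
      qed
      then have "x \<otimes> g = g \<otimes> x" if "g \<in> carrier G" for g
        using that x inv_solve_right'[of x "g \<otimes> x" g] by simp
      then have "x \<in> group_center G" using x unfolding group_center_def by blast
      then have "x = \<one>" using no by auto
      then show False using Osing Q(2) by simp
    qed
    moreover obtain i where "card Q = p ^ i"
      using divides_primepow_nat[OF p] \<open>card Q dvd p ^ k\<close> by blast
    ultimately show ?thesis by (cases i) auto
  qed
  have "orbit G ?\<phi> \<one> = (\<lambda>g. ?\<phi> g \<one>) ` carrier G"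
    unfolding orbit_def by blast
  also have "\<dots> = (\<lambda>g. \<one>) ` carrier G"
    by (rule image_cong) simp_all
  also have "\<dots> = {\<one>}" using one_closed by blast
  finally have "orbit G ?\<phi> \<one> = {\<one>}" .
  then have one: "{\<one>} \<in> orbits G (carrier G) ?\<phi>" unfolding orbits_def by (intro CollectI exI[of _ \<one>]) simp
  have finO: "finite (orbits G (carrier G) ?\<phi>)"
    using fin unfolding orbits_def setcompr_eq_image Collect_mem_eq by (rule finite_imageI)
  have "Coset.order G = (\<Sum>Q\<in>orbits G (carrier G) ?\<phi>. card Q)"
    using act.disjoint_sum[OF fin, of "\<lambda>_. 1::nat"] by (simp add: Coset.order_def)
  also have "\<dots> = 1 + (\<Sum>Q\<in>orbits G (carrier G) ?\<phi> - {{\<one>}}. card Q)"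
    using sum.remove[OF finO one, of card] by simp
  finally have "p ^ k = 1 + (\<Sum>Q\<in>orbits G (carrier G) ?\<phi> - {{\<one>}}. card Q)" using ord by simp
  moreover have "p dvd (\<Sum>Q\<in>orbits G (carrier G) ?\<phi> - {{\<one>}}. card Q)"
    by (rule dvd_sum, rule dvd) blast+
  moreover have "p dvd p ^ k"
  proof -
    have "k \<noteq> 0"
    proof
      assume "k = 0"
      then show False using ord nt order_one_triv_iff by simp
    qed
    then show ?thesis by simp
  qed
  ultimately have "p dvd 1 + (\<Sum>Q\<in>orbits G (carrier G) ?\<phi> - {{\<one>}}. card Q)"
    and "p dvd (\<Sum>Q\<in>orbits G (carrier G) ?\<phi> - {{\<one>}}. card Q)" by simp_all
  then have "p dvd 1" by (simp only: dvd_add_left_iff)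
  then show False using p by simp
qed


section \<open>Quotients that are minimal nonabelian\<close>

lemma (in group) prime_order_power:
  assumes fin: "finite (carrier G)" and x: "x \<in> carrier G" "x \<noteq> \<one>"
  obtains i r where "normalization_semidom_class.prime (r::nat)" "ord (x [^] (i::nat)) = r"
proof -
  have "ord x \<noteq> 1" using ord_eq_1[OF x(1)] x(2) by simp
  then obtain r where r: "normalization_semidom_class.prime r" "r dvd ord x" using prime_factor_nat by blast
  then obtain i where i: "ord x = i * r" by (auto elim!: dvdE simp: mult.commute)
  have "ord x > 0" using ord_ge_1[OF fin x(1)] by simp
  then have "ord (x [^] i) = r" using ord_pow[OF x(1), of i] i by simp
  then show ?thesis using that r by blast
qed

lemma only_prime_divisor_imp_prime_power:
  fixes n :: nat
  assumes p: "normalization_semidom_class.prime p" and n: "n > 0"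
    and only: "\<And>r. normalization_semidom_class.prime r \<Longrightarrow> r dvd n \<Longrightarrow> r = p"
  shows "\<exists>k. n = p ^ k"
proof -
  obtain m where m: "n = p ^ multiplicity p n * m" "\<not> p dvd m"
    using multiplicity_decompose'[of n p] n prime_gt_1_nat[OF p] by auto
  have "m = 1"
  proof (rule ccontr)
    assume "m \<noteq> 1"
    then obtain r where "normalization_semidom_class.prime r" "r dvd m" using prime_factor_nat by blast
    then have "r = p" using only[of r] m(1) by (metis dvd_mult)
    then show False using m(2) \<open>r dvd m\<close> by simp
  qed
  then show ?thesis using m(1) by auto
qed

text \<open>  This is \<open>[x ^ n, y] = [x, y] ^ n\<close> for a central commutator \<open>[x, y]\<close>, with the inverses cleared.\<close>

lemma (in group) central_commutator_power:
  assumes x: "x \<in> carrier G" and y: "y \<in> carrier G" and c: "commutator G x y \<in> group_center G"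
  shows "x [^] n \<otimes> y = commutator G x y [^] n \<otimes> (y \<otimes> x [^] (n::nat))"
proof (induction n)
  case (Suc n)
  let ?c = "commutator G x y"
  have cc: "?c \<in> carrier G" using x y by simp
  have xn: "x [^] n \<in> carrier G" using x by simp
  have cx: "?c \<otimes> x [^] n = x [^] n \<otimes> ?c" using c xn unfolding group_center_def by blast
  have "x [^] Suc n \<otimes> y = x [^] n \<otimes> ?c \<otimes> (y \<otimes> x)"
    using x y cc xn commutator_mult[OF x y] by (simp add: m_assoc)
  also have "\<dots> = ?c \<otimes> (x [^] n \<otimes> y) \<otimes> x"
    unfolding cx[symmetric] using x y cc xn by (simp add: m_assoc)
  also have "\<dots> = ?c \<otimes> ?c [^] n \<otimes> (y \<otimes> x [^] n) \<otimes> x"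
    unfolding Suc using x y cc xn by (simp add: m_assoc)
  also have "?c \<otimes> ?c [^] n = ?c [^] Suc n" using nat_pow_Suc2[OF cc] by simp
  finally show ?case using x y cc xn by (simp add: m_assoc)
qed (use x y in simp)

lemma (in group) generate_central_normal:
  assumes w: "w \<in> group_center G"
  shows "generate G {w} \<lhd> G"
proof -
  have wc: "w \<in> carrier G" using w by (simp add: group_center_def)
  have sub: "generate G {w} \<subseteq> group_center G"
    using generate_subgroup_incl[of "{w}" "group_center G"] w group_center_normal normal_imp_subgroup by blast
  show ?thesis
    unfolding normal_inv_iff
  proof (intro conjI ballI)
    show "subgroup (generate G {w}) G" using wc by (intro generate_is_subgroup) auto
    fix x h assume x: "x \<in> carrier G" and h: "h \<in> generate G {w}"
    have "h \<in> carrier G" "h \<otimes> x = x \<otimes> h" using sub h x by (auto simp: group_center_def)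
    then have "x \<otimes> h \<otimes> inv x = h" using x by (metis inv_solve_right m_closed)
    then show "x \<otimes> h \<otimes> inv x \<in> generate G {w}" using h by simp
  qed
qed

text \<open>  All commutators lie in every nontrivial normal subgroup, in particular in the subgroup generated by any
  central \<open>w \<noteq> \<one>\<close>. Hence all central elements of prime order have the same order \<open>p\<close>, and all
  commutators have order dividing \<open>p\<close> and are central. Therefore \<open>h ^ p\<close> is central for every \<open>h\<close>. An
  element \<open>h\<close> of prime order \<open>r \<noteq> p\<close> would give the central element \<open>h ^ p\<close> of order \<open>r\<close>, so by Cauchy's
  theorem \<open>p\<close> is the only prime divisor of the group order.\<close>

lemma (in group) minimal_nonabelian_quotient_p_group:
  assumes fin: "finite (carrier G)" and nc: "\<not> comm_group G"
    and min: "\<And>N x y. N \<lhd> G \<Longrightarrow> N \<noteq> {\<one>} \<Longrightarrow> x \<in> carrier G \<Longrightarrow> y \<in> carrier G \<Longrightarrow> commutator G x y \<in> N"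
    and z: "z \<in> group_center G" "z \<noteq> \<one>"
  obtains p :: nat where "normalization_semidom_class.prime p" "p_group p G"
proof -
  have Z: "x \<in> carrier G \<Longrightarrow> y \<in> carrier G \<Longrightarrow> commutator G x y \<in> group_center G" for x y
    using min[OF group_center_normal] z by blast
  have Zc: "w \<in> carrier G" if "w \<in> group_center G" for w using that by (simp add: group_center_def)
  obtain x y where xy: "x \<in> carrier G" "y \<in> carrier G" "commutator G x y \<noteq> \<one>"
    using nc comm_group_iff_commutators by auto
  have pow: "commutator G u v [^] r = \<one>"
    if w: "w \<in> group_center G" "w \<noteq> \<one>" "w [^] (r::nat) = \<one>" and uv: "u \<in> carrier G" "v \<in> carrier G" for w r u v
  proof -
    have "generate G {w} \<noteq> {\<one>}" using w(2) generate.incl[of w "{w}" G] by auto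
    then have "commutator G u v \<in> generate G {w}" using min[OF generate_central_normal[OF w(1)]] uv by blast
    then obtain i :: int where "commutator G u v = w [^] i" using generate_pow[OF Zc[OF w(1)]] by auto
    then have "commutator G u v [^] r = (w [^] r) [^] i"
      using Zc[OF w(1)] by (metis int_pow_int int_pow_pow mult.commute)
    then show ?thesis using w(3) by simp
  qed
  obtain i p where p: "normalization_semidom_class.prime p" and zi: "ord (z [^] (i::nat)) = p"
    using prime_order_power[OF fin Zc[OF z(1)] z(2)] by blast
  have cen_pow: "w [^] (j::nat) \<in> group_center G" if "w \<in> group_center G" for w j
  proof -
    interpret C: subgroup "group_center G" G using group_center_normal by (rule normal_imp_subgroup)
    show ?thesis using that by (induction j) auto
  qed
  have cp: "commutator G u v [^] p = \<one>" if "u \<in> carrier G" "v \<in> carrier G" for u v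
  proof (rule pow[OF cen_pow[OF z(1)]])
    show "z [^] i \<noteq> \<one>" using zi p by (auto simp: prime_gt_1_nat)
    show "(z [^] i) [^] p = \<one>" using zi Zc[OF cen_pow[OF z(1)]] pow_ord_eq_1 by blast
  qed fact+
  have central: "r = p" if w: "w \<in> group_center G" and r: "normalization_semidom_class.prime r" "ord w = r" for w r
  proof (rule ccontr)
    assume "r \<noteq> p"
    then have "coprime r p" using r p by (simp add: primes_coprime)
    have wc: "w \<in> carrier G" using Zc[OF w] .
    have "w \<noteq> \<one>" "w [^] r = \<one>" using r pow_ord_eq_1[OF wc] by auto
    then have "commutator G x y [^] r = \<one>" using pow[OF w] xy by blast
    then have "ord (commutator G x y) dvd r" using pow_eq_id xy by simp
    moreover have "ord (commutator G x y) dvd p" using pow_eq_id cp xy by simp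
    ultimately have "ord (commutator G x y) = 1" using \<open>coprime r p\<close> by (metis coprime_common_divisor_nat)
    then show False using ord_eq_1 xy by simp
  qed
  have "r = p" if r: "normalization_semidom_class.prime r" "r dvd Coset.order G" for r
  proof -
    obtain m where "Coset.order G = r ^ 1 * m" using r(2) by auto
    \<comment> \<open>Cauchy's theorem, as the case \<open>r ^ 1\<close> of Sylow's theorem.\<close>
    then obtain S where S: "subgroup S G" "card S = r" using sylow_thm[OF r(1) is_group _ fin] by fastforce
    then obtain h where h: "h \<in> S" "h \<noteq> \<one>" using r(1)
      by (metis card.empty card_1_singleton_iff card_insert_disjoint is_singletonI' is_singleton_altdef not_prime_1 subgroup.one_closed subset_singletonD subsetI equals0D)
    have hc: "h \<in> carrier G" using S(1) h(1) by (rule subgroup.mem_carrier)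
    have "ord h dvd r"
    proof -
      interpret S: group "G\<lparr>carrier := S\<rparr>" using S(1) by (rule subgroup_imp_group)
      have "h [^]\<^bsub>G\<lparr>carrier := S\<rparr>\<^esub> Coset.order (G\<lparr>carrier := S\<rparr>) = \<one>"
        using S.pow_order_eq_1[of h] h by simp
      then have "h [^] r = \<one>" using S(2) by (simp add: Coset.order_def nat_pow_consistent[symmetric])
      then show ?thesis using pow_eq_id[OF hc] by simp
    qed
    moreover have "ord h \<noteq> 1" using h(2) ord_eq_1[OF hc] by simp
    ultimately have oh: "ord h = r" using r(1) by (auto simp: prime_nat_iff)
    show ?thesis
    proof (rule ccontr)
      assume ne: "r \<noteq> p"
      have "h [^] p \<in> group_center G"
        unfolding group_center_def
      proof (intro CollectI conjI ballI)
        fix g assume g: "g \<in> carrier G"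
        show "h [^] p \<otimes> g = g \<otimes> h [^] p"
          using central_commutator_power[OF hc g Z[OF hc g], of p] cp[OF hc g] hc g by simp
      qed (use hc in simp)
      moreover have "ord (h [^] p) = r"
      proof -
        have "gcd r p = 1" using primes_coprime[OF r(1) p ne] by simp
        then show ?thesis using oh ord_pow_gen[OF hc, of p] p by (simp add: prime_gt_0_nat)
      qed
      ultimately show False using central r(1) ne by blast
    qed
  qed
  moreover have "Coset.order G > 0" using fin order_gt_0_iff_finite by simp
  ultimately have "\<exists>k. Coset.order G = p ^ k" using only_prime_divisor_imp_prime_power[OF p] by blast
  then show ?thesis using that p is_group by (auto simp: p_group_def)
qed


section \<open>Matrix sums and Fourier coefficients\<close>

text \<open>  The sums \<open>\<Sum>i<q. \<zeta> ^ (-i) * a i\<close> over the \<open>q\<close>-th roots of unity \<open>\<zeta>\<close> are the discrete Fourier coefficients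
  of the \<open>q\<close>-periodic sequence \<open>a\<close>. Shifting the sequence multiplies the coefficient at \<open>\<zeta>\<close> by \<open>\<zeta>\<close>. So if
  the coefficients at \<open>\<zeta> \<noteq> 1\<close> vanish, then all coefficients of the difference of \<open>a\<close> and its shift do, and
  the orthogonality of the characters of the cyclic group recovers \<open>a 1 - a 0 = 0\<close> from them.\<close>

lemma fourier_constant:
  fixes a :: "nat \<Rightarrow> complex"
  assumes q: "q > 0" and per: "a q = a 0"
    and z: "\<And>\<zeta>. \<zeta> ^ q = 1 \<Longrightarrow> \<zeta> \<noteq> 1 \<Longrightarrow> (\<Sum>i<q. inverse \<zeta> ^ i * a i) = 0"
  shows "a 1 = a 0"
proof -
  let ?R = "{\<zeta>::complex. \<zeta> ^ q = 1}"
  have fin: "finite ?R" using q by (intro finite_roots_unity) auto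
  have card: "card ?R = q" using q by (rule card_roots_unity_eq)
  have shift: "(\<Sum>i<q. inverse \<zeta> ^ i * (a (Suc i) - a i)) = 0" if \<zeta>: "\<zeta> \<in> ?R" for \<zeta>
  proof -
    have nz: "\<zeta> \<noteq> 0" using \<zeta> q by (auto simp: power_0_left)
    let ?b = "\<Sum>i<q. inverse \<zeta> ^ i * a i"
    have "inverse \<zeta> ^ q = 1" using \<zeta> by (simp add: power_inverse)
    then have "(\<Sum>i<q. inverse \<zeta> ^ Suc i * a (Suc i)) = ?b"
      using sum.lessThan_Suc_shift[of "\<lambda>i. inverse \<zeta> ^ i * a i" q] per by simp
    moreover have "(\<Sum>i<q. inverse \<zeta> ^ i * a (Suc i)) = \<zeta> * (\<Sum>i<q. inverse \<zeta> ^ Suc i * a (Suc i))"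
      unfolding sum_distrib_left using nz by (intro sum.cong) auto
    ultimately have "(\<Sum>i<q. inverse \<zeta> ^ i * (a (Suc i) - a i)) = (\<zeta> - 1) * ?b"
      by (simp add: right_diff_distrib sum_subtractf left_diff_distrib)
    also have "\<dots> = 0" using z[of \<zeta>] \<zeta> by (cases "\<zeta> = 1") auto
    finally show ?thesis .
  qed
  \<comment> \<open>Multiplying \<open>\<zeta>\<close> by a primitive root \<open>w\<close> permutes the roots and scales the sum by \<open>w ^ (-i) \<noteq> 1\<close>.\<close>
  have orth: "(\<Sum>\<zeta>\<in>?R. inverse \<zeta> ^ i) = (if i = 0 then of_nat q else 0)" if i: "i < q" for i
  proof (cases "i = 0")
    case False
    define w where "w = cis (2 * pi / real q)"
    have wq: "w ^ q = 1" using q by (simp add: w_def DeMoivre)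
    then have w0: "w \<noteq> 0" using q by (auto simp: power_0_left)
    have wi: "w ^ i \<noteq> 1"
    proof
      assume "w ^ i = 1"
      moreover have "w ^ i = cis (2 * pi * real i / real q)"
        by (simp add: w_def DeMoivre mult.commute)
      ultimately have "cis (2 * pi * real i / real q) = cis (2 * pi * real 0 / real q)" by simp
      then show False
        using bij_betw_roots_unity[OF q] i False unfolding bij_betw_def inj_on_def
        by (metis (no_types, lifting) lessThan_iff q)
    qed
    have inj: "bij_betw (\<lambda>\<zeta>. w * \<zeta>) ?R ?R"
    proof (rule bij_betwI[where g = "\<lambda>\<zeta>. inverse w * \<zeta>"])
    qed (use w0 wq in \<open>auto simp: power_mult_distrib power_inverse\<close>)
    have "(\<Sum>\<zeta>\<in>?R. inverse \<zeta> ^ i) = (\<Sum>\<zeta>\<in>?R. inverse (w * \<zeta>) ^ i)"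
      by (rule sum.reindex_bij_betw[OF inj, symmetric])
    also have "\<dots> = inverse (w ^ i) * (\<Sum>\<zeta>\<in>?R. inverse \<zeta> ^ i)"
      by (simp add: power_mult_distrib power_inverse sum_distrib_left)
    finally have "(1 - inverse (w ^ i)) * (\<Sum>\<zeta>\<in>?R. inverse \<zeta> ^ i) = 0"
      by (simp add: left_diff_distrib)
    then show ?thesis using wi False by (auto simp: inverse_eq_1_iff)
  qed (simp add: card)
  have "0 = (\<Sum>\<zeta>\<in>?R. \<Sum>i<q. inverse \<zeta> ^ i * (a (Suc i) - a i))"
    using shift by simp
  also have "\<dots> = (\<Sum>i<q. (\<Sum>\<zeta>\<in>?R. inverse \<zeta> ^ i) * (a (Suc i) - a i))"
    by (subst sum.swap) (simp add: sum_distrib_right)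
  also have "\<dots> = (\<Sum>i<q. if i = 0 then of_nat q * (a (Suc i) - a i) else 0)"
    by (intro sum.cong) (auto simp: orth)
  also have "\<dots> = of_nat q * (a 1 - a 0)"
    using q by (simp add: sum.delta)
  finally show ?thesis using q by simp
qed

text \<open>  The matrices of all sizes share one type, which therefore has no zero matrix to start a sum with. So the
  dimensions are arguments and the sum is taken entrywise.\<close>

definition mat_sum :: "nat \<Rightarrow> nat \<Rightarrow> ('i \<Rightarrow> complex mat) \<Rightarrow> 'i set \<Rightarrow> complex mat" where
  "mat_sum m n f I = mat m n (\<lambda>ij. \<Sum>k\<in>I. f k $$ ij)"

lemma mat_sum_carrier [simp]: "mat_sum m n f I \<in> carrier_mat m n"
  by (simp add: mat_sum_def)

lemma mult_mat_index:
  assumes "A \<in> carrier_mat l m" "B \<in> carrier_mat m n" "i < l" "j < n"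
  shows "(A * B) $$ (i, j) = (\<Sum>k<m. A $$ (i, k) * B $$ (k, j))"
  using assms by (auto simp: scalar_prod_def lessThan_atLeast0 intro!: sum.cong)

lemma mat_sum_mult_left:
  assumes A: "A \<in> carrier_mat l m" and f: "\<And>k. k \<in> I \<Longrightarrow> f k \<in> carrier_mat m n"
  shows "A * mat_sum m n f I = mat_sum l n (\<lambda>k. A * f k) I"
proof (rule eq_matI)
  fix i j assume "i < dim_row (mat_sum l n (\<lambda>k. A * f k) I)" "j < dim_col (mat_sum l n (\<lambda>k. A * f k) I)"
  then have ij: "i < l" "j < n" by (simp_all add: mat_sum_def)
  have "(A * mat_sum m n f I) $$ (i, j) = (\<Sum>k<m. A $$ (i, k) * (\<Sum>u\<in>I. f u $$ (k, j)))"
    using ij by (subst mult_mat_index[OF A mat_sum_carrier]) (auto simp: mat_sum_def)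
  also have "\<dots> = (\<Sum>u\<in>I. \<Sum>k<m. A $$ (i, k) * f u $$ (k, j))"
    unfolding sum_distrib_left by (rule sum.swap)
  also have "\<dots> = (\<Sum>u\<in>I. (A * f u) $$ (i, j))"
    using ij by (intro sum.cong refl mult_mat_index[OF A f, symmetric])
  finally show "(A * mat_sum m n f I) $$ (i, j) = mat_sum l n (\<lambda>k. A * f k) I $$ (i, j)"
    using ij by (simp add: mat_sum_def)
qed (use A in \<open>auto simp: mat_sum_def\<close>)

lemma mat_sum_mult_right:
  assumes A: "A \<in> carrier_mat n l" and f: "\<And>k. k \<in> I \<Longrightarrow> f k \<in> carrier_mat m n"
  shows "mat_sum m n f I * A = mat_sum m l (\<lambda>k. f k * A) I"
proof (rule eq_matI)
  fix i j assume "i < dim_row (mat_sum m l (\<lambda>k. f k * A) I)" "j < dim_col (mat_sum m l (\<lambda>k. f k * A) I)"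
  then have ij: "i < m" "j < l" by (simp_all add: mat_sum_def)
  have "(mat_sum m n f I * A) $$ (i, j) = (\<Sum>k<n. (\<Sum>u\<in>I. f u $$ (i, k)) * A $$ (k, j))"
    using ij by (subst mult_mat_index[OF mat_sum_carrier A]) (auto simp: mat_sum_def)
  also have "\<dots> = (\<Sum>u\<in>I. \<Sum>k<n. f u $$ (i, k) * A $$ (k, j))"
    unfolding sum_distrib_right by (rule sum.swap)
  also have "\<dots> = (\<Sum>u\<in>I. (f u * A) $$ (i, j))"
    using ij by (intro sum.cong refl mult_mat_index[OF f A, symmetric])
  finally show "(mat_sum m n f I * A) $$ (i, j) = mat_sum m l (\<lambda>k. f k * A) I $$ (i, j)"
    using ij by (simp add: mat_sum_def)
qed (use A in \<open>auto simp: mat_sum_def\<close>)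

lemma mat_sum_cong: "(\<And>k. k \<in> I \<Longrightarrow> f k = g k) \<Longrightarrow> mat_sum m n f I = mat_sum m n g I"
  by (simp add: mat_sum_def cong: sum.cong)

text \<open>  The map \<open>X \<mapsto> A X B\<close> has finite order on the orbit of \<open>X\<close>, so it is diagonalizable on its span, and the
  eigenvectors are the Fourier coefficients of the orbit. As \<open>X\<close> is not fixed, an eigenvalue \<open>\<zeta> \<noteq> 1\<close>
  occurs. The eigenvector \<open>F\<close> is a linear combination of the orbit, so it inherits every linear relation
  \<open>C Y = Y D\<close> that all \<open>Y\<close> in the orbit satisfy. With \<open>B\<close> inverse to \<open>A\<close> this concerns the
  conjugation by \<open>A\<close>; with \<open>X = B = 1\<close> it yields an eigenspace of \<open>A\<close>, the image of \<open>F\<close>.\<close>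

lemma conj_eigenmatrix:
  fixes A B X :: "complex mat"
  assumes A: "A \<in> carrier_mat n n" and B: "B \<in> carrier_mat n n" and X: "X \<in> carrier_mat n n"
    and q: "q > 0" and per: "A ^\<^sub>m q * X * B ^\<^sub>m q = X" and ne: "A * X * B \<noteq> X"
  obtains \<zeta> F where "\<zeta> ^ q = 1" "\<zeta> \<noteq> 1" "F \<in> carrier_mat n n" "F \<noteq> 0\<^sub>m n n" "A * F * B = \<zeta> \<cdot>\<^sub>m F"
    "\<And>C D. C \<in> carrier_mat n n \<Longrightarrow> D \<in> carrier_mat n n \<Longrightarrow>
      (\<And>i. C * (A ^\<^sub>m i * X * B ^\<^sub>m i) = (A ^\<^sub>m i * X * B ^\<^sub>m i) * D) \<Longrightarrow> C * F = F * D"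
proof -
  define M where "M i = A ^\<^sub>m i * X * B ^\<^sub>m i" for i
  have Ai: "A ^\<^sub>m i \<in> carrier_mat n n" and Bi: "B ^\<^sub>m i \<in> carrier_mat n n" for i
    using A B by (auto intro: pow_carrier_mat)
  have Mc: "M i \<in> carrier_mat n n" for i
    unfolding M_def by (rule mult_carrier_mat[OF mult_carrier_mat[OF Ai X] Bi])
  have Apow: "A ^\<^sub>m i * A = A * A ^\<^sub>m i" for i
  proof (induction i)
    case (Suc i)
    have "A ^\<^sub>m Suc i * A = (A * A ^\<^sub>m i) * A" using Suc by simp
    also have "\<dots> = A * A ^\<^sub>m Suc i" using assoc_mult_mat[OF A Ai A] by simp
    finally show ?case .
  qed (use A in simp)
  have assoc: "A * (P * X * Q) * B = (A * P) * X * (Q * B)"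
    if "P \<in> carrier_mat n n" "Q \<in> carrier_mat n n" for P Q
    using that A B X by (simp add: assoc_mult_mat[of _ n n _ n _ n])
  have MSuc: "A * M i * B = M (Suc i)" for i
    using assoc[OF Ai Bi, of i i] by (simp add: M_def Apow)
  have M0: "M 0 = X" and Mq: "M q = X" and M1: "M 1 = A * X * B"
    using A B X per MSuc[of 0] by (simp_all add: M_def)
  obtain i j where ij: "i < n" "j < n" "M 1 $$ (i, j) \<noteq> M 0 $$ (i, j)"
    using ne Mc[of 1] Mc[of 0] unfolding M1 M0 by (metis carrier_matD eq_matI)
  define F where "F \<zeta> = mat_sum n n (\<lambda>k. inverse \<zeta> ^ k \<cdot>\<^sub>m M k) {..<q}" for \<zeta>
  have Fij: "F \<zeta> $$ (i, j) = (\<Sum>k<q. inverse \<zeta> ^ k * M k $$ (i, j))" for \<zeta>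
    unfolding F_def mat_sum_def using ij by (simp add: carrier_matD[OF Mc])
  obtain \<zeta> where \<zeta>: "\<zeta> ^ q = 1" "\<zeta> \<noteq> 1" and nz: "F \<zeta> $$ (i, j) \<noteq> 0"
    using fourier_constant[of q "\<lambda>k. M k $$ (i, j)"] q ij(3) unfolding Fij M0 Mq by auto
  have \<zeta>0: "\<zeta> \<noteq> 0" using \<zeta> q by (auto simp: power_0_left)
  have Fc: "F \<zeta> \<in> carrier_mat n n" by (simp add: F_def)
  have sM: "inverse \<zeta> ^ k \<cdot>\<^sub>m M k \<in> carrier_mat n n" for k using Mc by simp
  have "A * F \<zeta> * B = mat_sum n n (\<lambda>k. A * (inverse \<zeta> ^ k \<cdot>\<^sub>m M k) * B) {..<q}"
    unfolding F_def mat_sum_mult_left[OF A sM] using A sM B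
    by (subst mat_sum_mult_right[OF B]) auto
  also have "\<dots> = mat_sum n n (\<lambda>k. inverse \<zeta> ^ k \<cdot>\<^sub>m M (Suc k)) {..<q}"
  proof (rule mat_sum_cong)
    fix k
    show "A * (inverse \<zeta> ^ k \<cdot>\<^sub>m M k) * B = inverse \<zeta> ^ k \<cdot>\<^sub>m M (Suc k)"
      using mult_smult_distrib[OF A Mc] mult_smult_assoc_mat[OF mult_carrier_mat[OF A Mc] B]
      by (simp add: MSuc)
  qed
  also have "\<dots> = \<zeta> \<cdot>\<^sub>m F \<zeta>"
  proof (rule eq_matI)
    fix a b assume "a < dim_row (\<zeta> \<cdot>\<^sub>m F \<zeta>)" "b < dim_col (\<zeta> \<cdot>\<^sub>m F \<zeta>)"
    then have ab: "a < n" "b < n" using Fc by auto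
    let ?m = "\<lambda>k. M k $$ (a, b)"
    have "inverse \<zeta> ^ q = 1" using \<zeta> by (simp add: power_inverse)
    then have "(\<Sum>k<q. inverse \<zeta> ^ Suc k * ?m (Suc k)) = (\<Sum>k<q. inverse \<zeta> ^ k * ?m k)"
      using sum.lessThan_Suc_shift[of "\<lambda>k. inverse \<zeta> ^ k * ?m k" q] M0 Mq by simp
    moreover have "(\<Sum>k<q. inverse \<zeta> ^ k * ?m (Suc k)) = \<zeta> * (\<Sum>k<q. inverse \<zeta> ^ Suc k * ?m (Suc k))"
      unfolding sum_distrib_left using \<zeta>0 by (intro sum.cong) auto
    ultimately show "mat_sum n n (\<lambda>k. inverse \<zeta> ^ k \<cdot>\<^sub>m M (Suc k)) {..<q} $$ (a, b) = (\<zeta> \<cdot>\<^sub>m F \<zeta>) $$ (a, b)"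
      using ab Mc by (simp add: F_def mat_sum_def carrier_matD[OF Mc])
  qed (simp_all add: F_def mat_sum_def)
  finally have "A * F \<zeta> * B = \<zeta> \<cdot>\<^sub>m F \<zeta>" .
  moreover have "C * F \<zeta> = F \<zeta> * D"
    if C: "C \<in> carrier_mat n n" and D: "D \<in> carrier_mat n n"
      and comm: "\<And>i. C * (A ^\<^sub>m i * X * B ^\<^sub>m i) = (A ^\<^sub>m i * X * B ^\<^sub>m i) * D" for C D
    unfolding F_def mat_sum_mult_left[OF C sM] mat_sum_mult_right[OF D sM]
    using mult_smult_distrib[OF C Mc] mult_smult_assoc_mat[OF Mc D] comm
    by (intro mat_sum_cong) (simp add: M_def)
  moreover have "F \<zeta> \<noteq> 0\<^sub>m n n" using nz ij by auto
  ultimately show ?thesis using that \<zeta> Fc by blast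
qed


section \<open>Matrix representations\<close>

lemma subspace_vec_iff:
  "subspace class_ring W (module_vec TYPE(complex) n) \<longleftrightarrow>
     W \<subseteq> carrier_vec n \<and> 0\<^sub>v n \<in> W \<and> (\<forall>v\<in>W. \<forall>w\<in>W. v + w \<in> W) \<and> (\<forall>c. \<forall>v\<in>W. c \<cdot>\<^sub>v v \<in> W)"
  (is "?L \<longleftrightarrow> ?R")
proof
  assume ?L
  then have "submodule class_ring W (module_vec TYPE(complex) n)"
    by (simp add: subspace_def)
  then show ?R
    unfolding submodule_def by (auto simp: module_vec_simps)
next
  assume ?R
  moreover have "vectorspace class_ring (module_vec TYPE(complex) n)" by (rule vec_vs)
  moreover from this have "module class_ring (module_vec TYPE(complex) n)"
    by (simp add: vectorspace_def)
  ultimately show ?L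
    unfolding subspace_def submodule_def by (auto simp: module_vec_simps)
qed

lemma subspace_vec_sum:
  assumes W: "subspace class_ring W (module_vec TYPE(complex) n)"
    and fin: "finite I" and f: "\<And>k. k \<in> I \<Longrightarrow> f k \<in> W"
  shows "vec n (\<lambda>i. \<Sum>k\<in>I. f k $ i) \<in> W"
  using fin f
proof (induction I rule: finite_induct)
  case empty
  have "vec n (\<lambda>i. 0) = (0\<^sub>v n :: complex vec)" by auto
  then show ?case using W by (simp add: subspace_vec_iff)
next
  case (insert k I)
  have "f k \<in> carrier_vec n" using W insert.prems by (auto simp: subspace_vec_iff)
  then have "vec n (\<lambda>i. \<Sum>k\<in>insert k I. f k $ i) = f k + vec n (\<lambda>i. \<Sum>k\<in>I. f k $ i)"
    using insert.hyps by (intro eq_vecI) auto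
  then show ?case using insert W by (simp add: subspace_vec_iff)
qed

lemma mat_trace_comm:
  assumes "A \<in> carrier_mat m n" "B \<in> carrier_mat n m"
  shows "mat_trace (A * B) = mat_trace (B * A)"
proof -
  have "mat_trace (A * B) = (\<Sum>i<m. \<Sum>k<n. A $$ (i, k) * B $$ (k, i))"
    using assms by (simp add: mat_trace_def mult_mat_index[OF assms] del: index_mult_mat(1))
  also have "\<dots> = (\<Sum>k<n. \<Sum>i<m. B $$ (k, i) * A $$ (i, k))"
    by (subst sum.swap) (simp add: mult.commute)
  also have "\<dots> = mat_trace (B * A)"
    using assms by (simp add: mat_trace_def mult_mat_index[OF assms(2,1)] del: index_mult_mat(1))
  finally show ?thesis .
qed

lemma GL_group: "group (GL n)"
  unfolding GL_def by (intro monoid.units_group ring.is_monoid ring_mat)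

locale matrix_rep = group G for G (structure) +
  fixes n :: nat and \<rho> :: "'a \<Rightarrow> complex mat"
  assumes rep: "representation G n \<rho>"
begin

lemma rep_carrier [simp]: "g \<in> carrier G \<Longrightarrow> \<rho> g \<in> carrier_mat n n"
  using rep by (auto simp: representation_def GL_def hom_def Pi_iff units_of_def Units_def ring_mat_simps)

lemma rep_mult: "g \<in> carrier G \<Longrightarrow> h \<in> carrier G \<Longrightarrow> \<rho> (g \<otimes> h) = \<rho> g * \<rho> h"
  using rep by (auto simp: representation_def GL_def hom_def units_of_def ring_mat_simps)

lemma rep_one [simp]: "\<rho> \<one> = 1\<^sub>m n"
proof -
  have "group_hom G (GL n) \<rho>"
    using rep GL_group by (auto simp: group_hom_def group_hom_axioms_def representation_def is_group)
  then have "\<rho> \<one> = \<one>\<^bsub>GL n\<^esub>" by (rule group_hom.hom_one)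
  then show ?thesis by (simp add: GL_def units_of_def ring_mat_simps)
qed

lemma rep_inv_l: "g \<in> carrier G \<Longrightarrow> \<rho> (inv g) * \<rho> g = 1\<^sub>m n"
  using rep_mult[of "inv g" g] by simp

lemma rep_inv_r: "g \<in> carrier G \<Longrightarrow> \<rho> g * \<rho> (inv g) = 1\<^sub>m n"
  using rep_mult[of g "inv g"] by simp

lemma rep_pow: "g \<in> carrier G \<Longrightarrow> \<rho> g ^\<^sub>m i = \<rho> (g [^] (i::nat))"
  by (induction i) (simp_all add: rep_mult carrier_matD[OF rep_carrier])

lemma rep_det: "g \<in> carrier G \<Longrightarrow> det (\<rho> g) * det (\<rho> (inv g)) = 1"
  using det_mult[of "\<rho> g" n "\<rho> (inv g)"] rep_inv_r[of g] by simp

lemma rep_cancel: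
  assumes g: "g \<in> carrier G" and X: "X \<in> carrier_mat n m"
  shows "\<rho> (inv g) * (\<rho> g * X) = X" and "\<rho> g * (\<rho> (inv g) * X) = X"
  using assms rep_inv_l[OF g] rep_inv_r[OF g]
  by (simp_all flip: assoc_mult_mat[of _ n n _ n _ m])

lemma rep_cancel_right:
  assumes g: "g \<in> carrier G" and X: "X \<in> carrier_mat m n"
  shows "X * \<rho> (inv g) * \<rho> g = X" and "X * \<rho> g * \<rho> (inv g) = X"
  using assms rep_inv_l[OF g] rep_inv_r[OF g]
  by (simp_all add: assoc_mult_mat[of _ m n _ n _ n])

lemma commute_inv:
  assumes g: "g \<in> carrier G" and X: "X \<in> carrier_mat n n" and c: "\<rho> g * X = X * \<rho> g"
  shows "\<rho> (inv g) * X = X * \<rho> (inv g)"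
proof -
  have "\<rho> (inv g) * X = \<rho> (inv g) * (X * \<rho> g * \<rho> (inv g))"
    using rep_cancel_right(2)[OF g X] by simp
  also have "\<dots> = \<rho> (inv g) * (\<rho> g * (X * \<rho> (inv g)))"
    using g X unfolding c[symmetric] by (simp add: assoc_mult_mat[of _ n n _ n _ n])
  also have "\<dots> = X * \<rho> (inv g)"
    using g X by (intro rep_cancel(1)[of _ _ n]) auto
  finally show ?thesis .
qed

lemma restrict_rep:
  assumes "subgroup S G"
  shows "matrix_rep (G\<lparr>carrier := S\<rparr>) n \<rho>"
proof -
  have "group (G\<lparr>carrier := S\<rparr>)" using assms by (rule subgroup_imp_group)
  moreover have "representation (G\<lparr>carrier := S\<rparr>) n \<rho>"
    using rep subgroup.subset[OF assms] by (auto simp: representation_def hom_def Pi_iff)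
  ultimately show ?thesis by (simp add: matrix_rep_def matrix_rep_axioms_def)
qed

end

lemma matrix_repI:
  assumes G: "group G"
    and car: "\<And>g. g \<in> carrier G \<Longrightarrow> \<rho> g \<in> carrier_mat n n"
    and mult: "\<And>g h. g \<in> carrier G \<Longrightarrow> h \<in> carrier G \<Longrightarrow> \<rho> (g \<otimes>\<^bsub>G\<^esub> h) = \<rho> g * \<rho> h"
    and one: "\<rho> \<one>\<^bsub>G\<^esub> = 1\<^sub>m n"
  shows "matrix_rep G n \<rho>"
proof -
  interpret group G by (rule G)
  have "\<rho> g \<in> Units (ring_mat TYPE(complex) n ())" if g: "g \<in> carrier G" for g
    using car[OF g] car[OF inv_closed[OF g]] mult[OF g inv_closed[OF g]] mult[OF inv_closed[OF g] g] one g
    by (auto simp: Units_def ring_mat_simps intro!: bexI[of _ "\<rho> (inv\<^bsub>G\<^esub> g)"])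
  then have "representation G n \<rho>"
    using mult by (auto simp: representation_def GL_def hom_def units_of_def ring_mat_simps)
  then show ?thesis using G by (simp add: matrix_rep_def matrix_rep_axioms_def)
qed

lemma irreducible_representation_rep:
  "group G \<Longrightarrow> irreducible_representation G n \<rho> \<Longrightarrow> matrix_rep G n \<rho>"
  by (simp add: matrix_rep_def matrix_rep_axioms_def irreducible_representation_def)


section \<open>Irreducibility and the commutant\<close>

text \<open>  This is irreducibility when \<open>S\<close> is the image of a finite group under a representation of positive degree.
  It only speaks of single matrices, and it applies directly to the images of subgroups.\<close>

definition scalar_commutant :: "nat \<Rightarrow> complex mat set \<Rightarrow> bool" where
  "scalar_commutant n S \<longleftrightarrow>
     (\<forall>X\<in>carrier_mat n n. (\<forall>A\<in>S. A * X = X * A) \<longrightarrow> (\<exists>c. X = c \<cdot>\<^sub>m 1\<^sub>m n))"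

lemma mult_mat_vec_eq_zero_imp:
  fixes X :: "complex mat"
  assumes X: "X \<in> carrier_mat n m" and z: "\<And>v. v \<in> carrier_vec m \<Longrightarrow> X *\<^sub>v v = 0\<^sub>v n"
  shows "X = 0\<^sub>m n m"
proof (rule eq_matI)
  fix i j assume "i < dim_row (0\<^sub>m n m :: complex mat)" "j < dim_col (0\<^sub>m n m :: complex mat)"
  then have ij: "i < n" "j < m" by auto
  have "(X *\<^sub>v unit_vec m j) $ i = X $$ (i, j)"
    using X ij by (simp add: row_def)
  then show "X $$ (i, j) = 0\<^sub>m n m $$ (i, j)"
    using z[of "unit_vec m j"] ij by simp
qed (use X in auto)

text \<open>  Schur's lemma in a form that also covers matrices commuting with the representation up to scalars:
  the hypothesis says just enough for the kernel of \<open>X\<close> to be an invariant subspace.\<close>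

lemma semi_invariant_invertible:
  assumes G: "group G" and irr: "irreducible_representation G n \<rho>"
    and X: "X \<in> carrier_mat n n" "X \<noteq> 0\<^sub>m n n"
    and semi: "\<And>g. g \<in> carrier G \<Longrightarrow> \<exists>Y\<in>carrier_mat n n. X * \<rho> g = Y * X"
  shows "det X \<noteq> 0"
proof
  interpret matrix_rep G n \<rho> by (rule irreducible_representation_rep[OF G irr])
  assume "det X = 0"
  then obtain v where v: "v \<in> carrier_vec n" "v \<noteq> 0\<^sub>v n" "X *\<^sub>v v = 0\<^sub>v n"
    using det_0_iff_vec_prod_zero_field[OF X(1)] by auto
  define W where "W = {v \<in> carrier_vec n. X *\<^sub>v v = 0\<^sub>v n}"
  have "invariant_subspace G n \<rho> W"
    unfolding invariant_subspace_def
  proof (intro conjI ballI)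
    show "subspace class_ring W (module_vec TYPE(complex) n)"
      unfolding subspace_vec_iff W_def using X(1)
      by (auto simp: mult_add_distrib_mat_vec[of _ n n] mult_mat_vec[of _ n n])
    fix g w assume g: "g \<in> carrier G" and w: "w \<in> W"
    obtain Y where Y: "Y \<in> carrier_mat n n" "X * \<rho> g = Y * X" using semi[OF g] by blast
    have "X *\<^sub>v (\<rho> g *\<^sub>v w) = (X * \<rho> g) *\<^sub>v w"
      using X(1) g w by (intro assoc_mult_mat_vec[symmetric]) (auto simp: W_def)
    also have "\<dots> = Y *\<^sub>v (X *\<^sub>v w)"
      using Y X(1) w by (simp add: W_def)
    also have "\<dots> = 0\<^sub>v n" using w Y by (intro eq_vecI) (auto simp: W_def)
    finally show "\<rho> g *\<^sub>v w \<in> W" using g w by (simp add: W_def mult_mat_vec_carrier[OF rep_carrier])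
  qed
  then have "W = {0\<^sub>v n} \<or> W = carrier_vec n"
    using irr by (simp add: irreducible_representation_def)
  moreover have "v \<in> W" using v by (simp add: W_def)
  ultimately have "W = carrier_vec n" using v(2) by auto
  then have "X = 0\<^sub>m n n"
    using X(1) by (intro mult_mat_vec_eq_zero_imp) (auto simp: W_def)
  then show False using X(2) by simp
qed

lemma singular_shift:
  assumes X: "X \<in> carrier_mat n n" and n: "n > 0"
  obtains k where "det (X - k \<cdot>\<^sub>m 1\<^sub>m n :: complex mat) = 0"
proof -
  obtain k where "eigenvalue X k" using spectrum_non_empty[OF X n] by (auto simp: spectrum_def)
  then have "det (char_matrix X k) = 0"
    using eigenvalue_det[OF X] by simp
  moreover have "char_matrix X k = X - k \<cdot>\<^sub>m 1\<^sub>m n"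
    using X by (intro eq_matI) (auto simp: char_matrix_def)
  ultimately show ?thesis using that by simp
qed

lemma schur:
  assumes G: "group G" and irr: "irreducible_representation G n \<rho>"
  shows "scalar_commutant n (\<rho> ` carrier G)"
  unfolding scalar_commutant_def
proof (intro ballI impI)
  interpret matrix_rep G n \<rho> by (rule irreducible_representation_rep[OF G irr])
  fix X :: "complex mat" assume X: "X \<in> carrier_mat n n" and c: "\<forall>A\<in>\<rho> ` carrier G. A * X = X * A"
  have "n > 0" using irr by (simp add: irreducible_representation_def)
  then obtain k where k: "det (X - k \<cdot>\<^sub>m 1\<^sub>m n) = 0" using singular_shift X by blast
  let ?Y = "X - k \<cdot>\<^sub>m 1\<^sub>m n"
  have Y: "?Y \<in> carrier_mat n n" by (rule minus_carrier_mat) simp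
  have "?Y * \<rho> g = \<rho> g * ?Y" if g: "g \<in> carrier G" for g
    using c g X by (simp add: minus_mult_distrib_mat[of _ n n _ _ n] mult_minus_distrib_mat[of _ n n _ n]
      mult_smult_distrib[of _ n n _ n] mult_smult_assoc_mat[of _ n n _ n]
      left_mult_one_mat[OF rep_carrier[OF g]] right_mult_one_mat[OF rep_carrier[OF g]])
  then have "?Y = 0\<^sub>m n n"
    using semi_invariant_invertible[OF G irr Y] k by fastforce
  then have "X = k \<cdot>\<^sub>m 1\<^sub>m n"
    using X by (auto simp: mat_eq_iff)
  then show "\<exists>c. X = c \<cdot>\<^sub>m 1\<^sub>m n" by blast
qed

text \<open>  If \<open>W\<close> is invariant and contains \<open>w \<noteq> 0\<close>, let \<open>P\<close> be the matrix with one column \<open>w\<close>, placed so that its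
  trace is not zero, and all other columns zero. Averaging \<open>P\<close> over the group gives a matrix that commutes
  with the representation, maps into \<open>W\<close> and has nonzero trace. It is a nonzero scalar, so \<open>W\<close> is
  everything.\<close>

lemma (in matrix_rep) irreducibleI:
  assumes fin: "finite (carrier G)" and n: "n > 0"
    and sc: "scalar_commutant n (\<rho> ` carrier G)"
  shows "irreducible_representation G n \<rho>"
  unfolding irreducible_representation_def
proof (intro conjI allI impI rep n)
  fix W assume W: "invariant_subspace G n \<rho> W"
  then have sub: "subspace class_ring W (module_vec TYPE(complex) n)"
    and inv: "\<And>g w. g \<in> carrier G \<Longrightarrow> w \<in> W \<Longrightarrow> \<rho> g *\<^sub>v w \<in> W"
    by (auto simp: invariant_subspace_def)
  have Wc: "W \<subseteq> carrier_vec n" and W0: "0\<^sub>v n \<in> W" and Ws: "\<And>c v. v \<in> W \<Longrightarrow> c \<cdot>\<^sub>v v \<in> W"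
    using sub by (auto simp: subspace_vec_iff)
  show "W = {0\<^sub>v n} \<or> W = carrier_vec n"
  proof (rule disjCI)
    assume ne: "W \<noteq> carrier_vec n"
    show "W = {0\<^sub>v n}"
    proof (rule ccontr)
      assume "W \<noteq> {0\<^sub>v n}"
      then obtain w where w: "w \<in> W" "w \<noteq> 0\<^sub>v n" using W0 by auto
      then obtain a where a: "a < n" "w $ a \<noteq> 0" using Wc by (auto simp: vec_eq_iff)
      have wc: "w \<in> carrier_vec n" using w Wc by auto
      define P where "P = mat n n (\<lambda>(i, j). if j = a then w $ i else 0)"
      have Pc: "P \<in> carrier_mat n n" by (simp add: P_def)
      have Pu: "P *\<^sub>v u = u $ a \<cdot>\<^sub>v w" if "u \<in> carrier_vec n" for u
      proof (rule eq_vecI)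
        fix i assume "i < dim_vec (u $ a \<cdot>\<^sub>v w)"
        then have i: "i < n" using wc by simp
        then have "(P *\<^sub>v u) $ i = (\<Sum>j = 0..<n. (if j = a then w $ i else 0) * u $ j)"
          using that by (simp add: P_def scalar_prod_def)
        also have "\<dots> = (\<Sum>j = 0..<n. if j = a then w $ i * u $ j else 0)"
          by (intro sum.cong) auto
        also have "\<dots> = (u $ a \<cdot>\<^sub>v w) $ i"
          using a i wc by simp
        finally show "(P *\<^sub>v u) $ i = (u $ a \<cdot>\<^sub>v w) $ i" .
      qed (use wc in \<open>simp add: P_def\<close>)
      have Ptr: "mat_trace P = w $ a" using a by (simp add: mat_trace_def P_def sum.delta)
      define T where "T h = \<rho> h * P * \<rho> (inv h)" for h
      have Tc: "T h \<in> carrier_mat n n" if "h \<in> carrier G" for h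
        using that Pc by (auto simp: T_def intro!: mult_carrier_mat)
      define X where "X = mat_sum n n T (carrier G)"
      have Xc: "X \<in> carrier_mat n n" by (simp add: X_def)
      have comm: "\<rho> g * X = X * \<rho> g" if g: "g \<in> carrier G" for g
      proof -
        have bij: "bij_betw (\<lambda>h. g \<otimes> h) (carrier G) (carrier G)"
          by (rule bij_betwI[where g = "\<lambda>h. inv g \<otimes> h"]) (use g in \<open>auto simp: m_assoc[symmetric]\<close>)
        have assoc: "A * (B * P * (E * A)) = (A * B) * P * E * A"
          if "A \<in> carrier_mat n n" "B \<in> carrier_mat n n" "E \<in> carrier_mat n n" for A B E
          using that Pc by (simp add: assoc_mult_mat[of _ n n _ n _ n])
        have "\<rho> g * X = mat_sum n n (\<lambda>h. \<rho> g * T h) (carrier G)"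
          unfolding X_def using g Tc by (intro mat_sum_mult_left) auto
        also have "\<dots> = mat_sum n n (\<lambda>h. T (g \<otimes> h) * \<rho> g) (carrier G)"
        proof (rule mat_sum_cong)
          fix h assume h: "h \<in> carrier G"
          have "\<rho> (inv (g \<otimes> h)) * \<rho> g = \<rho> (inv h)"
            using g h by (simp flip: rep_mult) (simp add: inv_mult_group m_assoc)
          then show "\<rho> g * T h = T (g \<otimes> h) * \<rho> g"
            using assoc[of "\<rho> g" "\<rho> h" "\<rho> (inv (g \<otimes> h))"] g h by (simp add: T_def rep_mult)
        qed
        also have "\<dots> = mat_sum n n (\<lambda>h. T (g \<otimes> h)) (carrier G) * \<rho> g"
          using g Tc by (intro mat_sum_mult_right[symmetric]) auto
        also have "mat_sum n n (\<lambda>h. T (g \<otimes> h)) (carrier G) = X"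
          unfolding X_def mat_sum_def by (simp add: sum.reindex_bij_betw[OF bij, of "\<lambda>h. T h $$ ij" for ij])
        finally show ?thesis .
      qed
      obtain c where c: "X = c \<cdot>\<^sub>m 1\<^sub>m n"
        using sc comm Xc unfolding scalar_commutant_def by blast
      have "mat_trace (T h) = w $ a" if h: "h \<in> carrier G" for h
      proof -
        have "mat_trace (T h) = mat_trace (\<rho> (inv h) * (\<rho> h * P))"
          unfolding T_def using h Pc by (intro mat_trace_comm[of _ n n]) (auto intro!: mult_carrier_mat)
        then show ?thesis using rep_cancel(1)[OF h Pc] Ptr by simp
      qed
      then have "of_nat (card (carrier G)) * w $ a = (\<Sum>h\<in>carrier G. mat_trace (T h))"
        by simp
      also have "\<dots> = mat_trace X"
        unfolding mat_trace_def X_def mat_sum_def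
        by (simp add: carrier_matD[OF Tc] sum.swap[of _ "{..<n}"])
      also have "\<dots> = of_nat n * c"
        by (simp add: c mat_trace_def)
      finally have "c \<noteq> 0"
        using a fin one_closed by (metis card_eq_0_iff empty_iff mult_eq_0_iff of_nat_eq_0_iff)
      have "v \<in> W" if v: "v \<in> carrier_vec n" for v
      proof -
        have TW: "T h *\<^sub>v v \<in> W" if h: "h \<in> carrier G" for h
        proof -
          have u: "\<rho> (inv h) *\<^sub>v v \<in> carrier_vec n"
            by (rule mult_mat_vec_carrier[OF rep_carrier[OF inv_closed[OF h]] v])
          have "T h *\<^sub>v v = \<rho> h *\<^sub>v (P *\<^sub>v (\<rho> (inv h) *\<^sub>v v))"
            unfolding T_def assoc_mult_mat_vec[OF mult_carrier_mat[OF rep_carrier[OF h] Pc] rep_carrier[OF inv_closed[OF h]] v]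
            by (rule assoc_mult_mat_vec[OF rep_carrier[OF h] Pc u])
          also have "P *\<^sub>v (\<rho> (inv h) *\<^sub>v v) = (\<rho> (inv h) *\<^sub>v v) $ a \<cdot>\<^sub>v w" by (rule Pu[OF u])
          finally show ?thesis using inv[OF h] Ws w by simp
        qed
        have "vec n (\<lambda>i. \<Sum>h\<in>carrier G. (T h *\<^sub>v v) $ i) \<in> W"
          using sub fin TW by (rule subspace_vec_sum)
        moreover have "vec n (\<lambda>i. \<Sum>h\<in>carrier G. (T h *\<^sub>v v) $ i) = X *\<^sub>v v"
        proof (rule eq_vecI)
          fix i assume "i < dim_vec (X *\<^sub>v v)"
          then have i: "i < n" using Xc by simp
          have "(\<Sum>h\<in>carrier G. (T h *\<^sub>v v) $ i) = (\<Sum>h\<in>carrier G. \<Sum>j<n. T h $$ (i, j) * v $ j)"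
            using i v Tc by (intro sum.cong) (auto simp: scalar_prod_def lessThan_atLeast0 carrier_matD[OF Tc])
          also have "\<dots> = (\<Sum>j<n. (\<Sum>h\<in>carrier G. T h $$ (i, j)) * v $ j)"
            unfolding sum_distrib_right by (rule sum.swap)
          also have "\<dots> = (X *\<^sub>v v) $ i"
            using i v by (simp add: X_def mat_sum_def scalar_prod_def lessThan_atLeast0)
          finally show "vec n (\<lambda>i. \<Sum>h\<in>carrier G. (T h *\<^sub>v v) $ i) $ i = (X *\<^sub>v v) $ i"
            using i by simp
        qed (use Xc in simp)
        moreover have "X *\<^sub>v v = c \<cdot>\<^sub>v v"
          using v by (intro eq_vecI) (auto simp: c)
        ultimately have "inverse c \<cdot>\<^sub>v (c \<cdot>\<^sub>v v) \<in> W" using Ws by metis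
        then show ?thesis using \<open>c \<noteq> 0\<close> by (simp add: smult_smult_assoc)
      qed
      then show False using ne Wc by auto
    qed
  qed
qed


section \<open>Restriction along a subnormal chain\<close>

lemma root_of_unity_coprime_exponents:
  fixes z :: complex
  assumes "z ^ a = 1" "z ^ b = 1" "coprime a b" "a > 0"
  shows "z = 1"
proof -
  obtain x y where "a * x = b * y + 1"
    using bezout_nat[of a b] assms(3,4) by (auto simp: coprime_iff_gcd_eq_1)
  then have "(z ^ a) ^ x = (z ^ b) ^ y * z"
    by (metis power_mult power_add power_one_right)
  then show ?thesis using assms by simp
qed

context matrix_rep
begin

text \<open>  One step of the descent. Let \<open>X\<close> commute with \<open>\<rho>(M)\<close>; it suffices that \<open>X\<close> also commutes with \<open>\<rho>(g)\<close>,
  for then it commutes with the image of a subgroup containing \<open>M\<close> and \<open>g\<close>. Conjugation by \<open>\<rho>(g)\<close> acts on the commutant of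
  \<open>\<rho>(M)\<close> with order dividing \<open>q\<close>. If it moved \<open>X\<close>, there would be an eigenvector \<open>F\<close> in the commutant with
  an eigenvalue \<open>\<zeta> \<noteq> 1\<close>. The elements that commute with \<open>F\<close> up to scalars form a group \<open>S\<close> containing \<open>M\<close> and \<open>g\<close>,
  on which the representation is irreducible; so \<open>F\<close> is invertible, and taking determinants gives
  \<open>\<zeta> ^ n = 1\<close>, contrary to \<open>\<zeta> ^ q = 1\<close>.\<close>

lemma scalar_commutant_normalized:
  assumes fin: "finite (carrier G)" and n: "n > 0"
    and M: "subgroup M G" and g: "g \<in> carrier G"
    and norm: "\<And>m. m \<in> M \<Longrightarrow> inv g \<otimes> m \<otimes> g \<in> M"
    and q: "q > 0" "g [^] (q::nat) \<in> M" "coprime q n"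
    and larger: "\<And>S. subgroup S G \<Longrightarrow> M \<subseteq> S \<Longrightarrow> g \<in> S \<Longrightarrow> scalar_commutant n (\<rho> ` S)"
  shows "scalar_commutant n (\<rho> ` M)"
proof -
  let ?C = "{X \<in> carrier_mat n n. \<forall>m\<in>M. \<rho> m * X = X * \<rho> m}"
  have Mc: "m \<in> carrier G" if "m \<in> M" for m using M that by (rule subgroup.mem_carrier)
  have fixed: "\<rho> g * X * \<rho> (inv g) = X" if X: "X \<in> ?C" for X
  proof (rule ccontr)
    assume ne: "\<rho> g * X * \<rho> (inv g) \<noteq> X"
    have Xc: "X \<in> carrier_mat n n" using X by simp
    have conj: "inv (g [^] i) \<otimes> m \<otimes> g [^] i \<in> M" if m: "m \<in> M" for m and i :: nat
    proof (induction i)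
      case (Suc i)
      have "inv (g [^] Suc i) \<otimes> m \<otimes> g [^] Suc i = inv g \<otimes> (inv (g [^] i) \<otimes> m \<otimes> g [^] i) \<otimes> g"
        using g Mc[OF m] by (simp add: inv_mult_group m_assoc)
      then show ?case using norm[OF Suc] by simp
    qed (use m Mc[OF m] in simp)
    have "\<rho> g ^\<^sub>m q * X * \<rho> (inv g) ^\<^sub>m q = X"
    proof -
      have "\<rho> g ^\<^sub>m q * X = X * \<rho> (g [^] q)"
        using X q(2) by (simp add: rep_pow[OF g])
      moreover have "\<rho> (inv g) ^\<^sub>m q = \<rho> (inv (g [^] q))"
        using g by (simp add: rep_pow nat_pow_inv)
      ultimately show ?thesis using rep_cancel_right(2)[of "g [^] q" X n] g Xc by simp
    qed
    then obtain \<zeta> F where \<zeta>: "\<zeta> ^ q = 1" "\<zeta> \<noteq> 1" and F: "F \<in> carrier_mat n n" "F \<noteq> 0\<^sub>m n n"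
      and gF: "\<rho> g * F * \<rho> (inv g) = \<zeta> \<cdot>\<^sub>m F"
      and comm: "\<And>C D. C \<in> carrier_mat n n \<Longrightarrow> D \<in> carrier_mat n n \<Longrightarrow>
        (\<And>i. C * (\<rho> g ^\<^sub>m i * X * \<rho> (inv g) ^\<^sub>m i) = (\<rho> g ^\<^sub>m i * X * \<rho> (inv g) ^\<^sub>m i) * D) \<Longrightarrow> C * F = F * D"
      using conj_eigenmatrix[OF rep_carrier[OF g] rep_carrier[OF inv_closed[OF g]] Xc q(1) _ ne] by metis
    have FM: "\<rho> m * F = F * \<rho> m" if m: "m \<in> M" for m
    proof (rule comm)
      fix i :: nat
      let ?h = "g [^] i" and ?m = "inv (g [^] i) \<otimes> m \<otimes> g [^] i"
      have h: "?h \<in> carrier G" "inv ?h \<in> carrier G" and m': "?m \<in> carrier G" "\<rho> ?m * X = X * \<rho> ?m"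
        using g conj[OF m] X Mc by auto
      have inv: "\<rho> (inv g) ^\<^sub>m i = \<rho> (inv ?h)"
        using g by (simp add: rep_pow nat_pow_inv)
      have e1: "\<rho> m * \<rho> ?h = \<rho> ?h * \<rho> ?m" and e2: "\<rho> ?m * \<rho> (inv ?h) = \<rho> (inv ?h) * \<rho> m"
        using h Mc[OF m] by (simp_all flip: rep_mult) (simp_all add: m_assoc[symmetric], simp add: m_assoc)
      have assoc: "A * (B * X * D) = (A * B) * X * D" "(B * A') * X * D = B * (A' * X) * D" "B * (X * A') * D = B * X * (A' * D)"
         "B * X * (D * A) = B * X * D * A"
        if "A \<in> carrier_mat n n" "A' \<in> carrier_mat n n" "B \<in> carrier_mat n n" "D \<in> carrier_mat n n" for A A' B D
        using that Xc by (simp_all add: assoc_mult_mat[of _ n n _ n _ n])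
      note assoc = assoc[OF rep_carrier[OF Mc[OF m]] rep_carrier[OF m'(1)] rep_carrier[OF h(1)] rep_carrier[OF h(2)]]
      show "\<rho> m * (\<rho> g ^\<^sub>m i * X * \<rho> (inv g) ^\<^sub>m i) = \<rho> g ^\<^sub>m i * X * \<rho> (inv g) ^\<^sub>m i * \<rho> m"
        unfolding inv rep_pow[OF g] assoc(1) e1 assoc(2) m'(2) assoc(3) e2 assoc(4) ..
    qed (use Mc[OF m] in auto)
    have gF': "\<rho> g * F = \<zeta> \<cdot>\<^sub>m (F * \<rho> g)"
    proof -
      have "\<rho> g * F = \<rho> g * F * \<rho> (inv g) * \<rho> g"
        by (rule rep_cancel_right(1)[OF g mult_carrier_mat[OF rep_carrier[OF g] F(1)], symmetric])
      then show ?thesis using gF F g mult_smult_assoc_mat[of F n n "\<rho> g" n \<zeta>] by simp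
    qed
    have \<zeta>0: "\<zeta> \<noteq> 0" using \<zeta> q(1) by (auto simp: power_0_left)
    define S where "S = {h \<in> carrier G. \<exists>y. y \<noteq> 0 \<and> \<rho> h * F = y \<cdot>\<^sub>m (F * \<rho> h)}"
    have S: "subgroup S G"
    proof (rule subgroupI)
      show "S \<subseteq> carrier G" by (auto simp: S_def)
      have "\<one> \<in> S" using F by (auto simp: S_def intro!: exI[of _ 1])
      then show "S \<noteq> {}" by auto
    next
      fix h assume "h \<in> S"
      then obtain y where h: "h \<in> carrier G" and y: "y \<noteq> 0" "\<rho> h * F = y \<cdot>\<^sub>m (F * \<rho> h)"
        by (auto simp: S_def)
      have "F * \<rho> (inv h) = \<rho> (inv h) * (\<rho> h * F) * \<rho> (inv h)"
        using rep_cancel(1)[OF h F(1)] by simp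
      also have "\<dots> = y \<cdot>\<^sub>m (\<rho> (inv h) * (F * \<rho> h) * \<rho> (inv h))"
        unfolding y(2) using h F(1)
        by (simp add: mult_smult_distrib[of _ n n _ n] mult_smult_assoc_mat[of _ n n _ n] mult_carrier_mat[of _ n n])
      also have "\<rho> (inv h) * (F * \<rho> h) * \<rho> (inv h) = \<rho> (inv h) * (F * \<rho> h * \<rho> (inv h))"
        using h F(1) by (intro assoc_mult_mat[of _ n n _ n _ n]) auto
      also have "F * \<rho> h * \<rho> (inv h) = F" by (rule rep_cancel_right(2)[OF h F(1)])
      finally have "\<rho> (inv h) * F = inverse y \<cdot>\<^sub>m (F * \<rho> (inv h))"
        using y(1) by (auto simp: mat_eq_iff)
      then show "inv h \<in> S" using h y(1) by (auto simp: S_def intro!: exI[of _ "inverse y"])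
    next
      fix h k assume "h \<in> S" "k \<in> S"
      then obtain y z where h: "h \<in> carrier G" and y: "y \<noteq> 0" "\<rho> h * F = y \<cdot>\<^sub>m (F * \<rho> h)"
        and k: "k \<in> carrier G" and z: "z \<noteq> 0" "\<rho> k * F = z \<cdot>\<^sub>m (F * \<rho> k)"
        by (auto simp: S_def)
      have "\<rho> (h \<otimes> k) * F = \<rho> h * (\<rho> k * F)"
        using h k F(1) by (simp add: rep_mult assoc_mult_mat[of _ n n _ n _ n])
      also have "\<dots> = z \<cdot>\<^sub>m (\<rho> h * F * \<rho> k)"
        unfolding z(2) using h k F(1)
        by (simp add: mult_smult_distrib[of _ n n _ n] mult_carrier_mat[of _ n n] assoc_mult_mat[of _ n n _ n _ n])
      also have "\<dots> = (y * z) \<cdot>\<^sub>m (F * \<rho> (h \<otimes> k))"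
        unfolding y(2) using h k F(1)
        by (simp add: mult_smult_assoc_mat[of _ n n _ n] mult_carrier_mat[of _ n n] rep_mult assoc_mult_mat[of _ n n _ n _ n])
           (auto simp: mat_eq_iff)
      finally show "h \<otimes> k \<in> S" using h k y(1) z(1) by (auto simp: S_def intro!: exI[of _ "y * z"])
    qed
    have MS: "M \<subseteq> S"
    proof
      fix m assume m: "m \<in> M"
      have "\<rho> m * F = 1 \<cdot>\<^sub>m (F * \<rho> m)" using FM[OF m] by (auto simp: mat_eq_iff)
      then show "m \<in> S" using Mc[OF m] by (auto simp: S_def intro!: exI[of _ 1])
    qed
    have gS: "g \<in> S" using g gF' \<zeta>0 by (auto simp: S_def)
    interpret S: matrix_rep "G\<lparr>carrier := S\<rparr>" n \<rho> by (rule restrict_rep[OF S])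
    have irr: "irreducible_representation (G\<lparr>carrier := S\<rparr>) n \<rho>"
      using larger[OF S MS gS] n finite_subset[OF subgroup.subset[OF S] fin] by (intro S.irreducibleI) auto
    have "det F \<noteq> 0"
    proof (rule semi_invariant_invertible[OF S.is_group irr F])
      fix h assume "h \<in> carrier (G\<lparr>carrier := S\<rparr>)"
      then obtain y where h: "h \<in> carrier G" and y: "y \<noteq> 0" "\<rho> h * F = y \<cdot>\<^sub>m (F * \<rho> h)"
        by (auto simp: S_def)
      have "inverse y \<cdot>\<^sub>m \<rho> h * F = inverse y \<cdot>\<^sub>m (\<rho> h * F)"
        using h F(1) by (intro mult_smult_assoc_mat[of _ n n _ n]) auto
      also have "\<dots> = F * \<rho> h" unfolding y(2) using y(1) by (auto simp: mat_eq_iff)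
      finally show "\<exists>Y\<in>carrier_mat n n. F * \<rho> h = Y * F"
        using h by (intro bexI[of _ "inverse y \<cdot>\<^sub>m \<rho> h"]) auto
    qed
    moreover have "det (\<rho> g) * det F = \<zeta> ^ n * (det F * det (\<rho> g))"
      using arg_cong[OF gF', of det] det_mult[OF rep_carrier[OF g] F(1)] det_mult[OF F(1) rep_carrier[OF g]]
        carrier_matD[OF rep_carrier[OF g]] by simp
    moreover have "det (\<rho> g) \<noteq> 0" using rep_det[OF g] by auto
    ultimately have "\<zeta> ^ n = 1" by simp
    then show False using root_of_unity_coprime_exponents[OF \<zeta>(1) _ q(3,1)] \<zeta>(2) by simp
  qed
  have gX: "\<rho> g * X = X * \<rho> g" if X: "X \<in> ?C" for X
  proof -
    have "X * \<rho> g = \<rho> g * X * \<rho> (inv g) * \<rho> g" using fixed[OF X] by simp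
    also have "\<dots> = \<rho> g * X"
      using X by (intro rep_cancel_right(1)[OF g mult_carrier_mat[OF rep_carrier[OF g]]]) simp
    finally show ?thesis by simp
  qed
  define S where "S = {h \<in> carrier G. \<forall>X\<in>?C. \<rho> h * X = X * \<rho> h}"
  have S: "subgroup S G"
  proof (rule subgroupI)
    show "S \<subseteq> carrier G" by (auto simp: S_def)
    have "\<one> \<in> S" by (auto simp: S_def)
    then show "S \<noteq> {}" by auto
  next
    fix h assume "h \<in> S"
    then show "inv h \<in> S" using commute_inv by (auto simp: S_def)
  next
    fix h k assume h: "h \<in> S" and k: "k \<in> S"
    have hk: "h \<in> carrier G" "k \<in> carrier G" using h k by (auto simp: S_def)
    have "\<rho> (h \<otimes> k) * X = X * \<rho> (h \<otimes> k)" if X: "X \<in> ?C" for X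
    proof -
      have Xc: "X \<in> carrier_mat n n" using X by simp
      have "\<rho> (h \<otimes> k) * X = \<rho> h * (\<rho> k * X)"
        using hk Xc by (simp add: rep_mult assoc_mult_mat[of _ n n _ n _ n])
      also have "\<dots> = \<rho> h * X * \<rho> k"
        using k X hk Xc by (simp add: S_def assoc_mult_mat[of _ n n _ n _ n])
      also have "\<dots> = X * \<rho> h * \<rho> k" using h X by (auto simp: S_def)
      also have "\<dots> = X * \<rho> (h \<otimes> k)"
        using hk Xc by (simp add: rep_mult assoc_mult_mat[of _ n n _ n _ n])
      finally show ?thesis .
    qed
    then show "h \<otimes> k \<in> S" using hk by (auto simp: S_def)
  qed
  have "scalar_commutant n (\<rho> ` S)"
    using S Mc g gX by (intro larger) (auto simp: S_def)
  then show ?thesis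
    unfolding scalar_commutant_def by (auto simp: S_def)
qed

text \<open>  Take \<open>M\<close> maximal among the subgroups above \<open>K\<close> on which \<open>\<rho>\<close> has a nonscalar commutant. An element \<open>g\<close>
  outside \<open>M\<close> that normalizes \<open>M\<close> contradicts the preceding lemma.\<close>

lemma scalar_commutant_restrict:
  assumes fin: "finite (carrier G)" and irr: "irreducible_representation G n \<rho>"
    and K: "subgroup K G" and p: "normalization_semidom_class.prime (p::nat)" "\<not> p dvd n"
    and norm: "\<And>M. subgroup M G \<Longrightarrow> K \<subseteq> M \<Longrightarrow> M \<noteq> carrier G \<Longrightarrow>
      \<exists>g\<in>carrier G - M. \<forall>m\<in>M. inv g \<otimes> m \<otimes> g \<in> M"
    and pow: "\<And>g. g \<in> carrier G \<Longrightarrow> \<exists>k. g [^] (p ^ k :: nat) \<in> K"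
  shows "scalar_commutant n (\<rho> ` K)"
proof (rule ccontr)
  assume nK: "\<not> scalar_commutant n (\<rho> ` K)"
  define \<M> where "\<M> = {M. subgroup M G \<and> K \<subseteq> M \<and> \<not> scalar_commutant n (\<rho> ` M)}"
  have "\<M> \<subseteq> Pow (carrier G)" by (auto simp: \<M>_def dest: subgroup.subset)
  then have "finite \<M>" using fin by (simp add: finite_subset)
  moreover have "K \<in> \<M>" using K nK by (simp add: \<M>_def)
  ultimately obtain M where M: "M \<in> \<M>" and max: "\<And>S. S \<in> \<M> \<Longrightarrow> M \<subseteq> S \<Longrightarrow> M = S"
    using finite_has_maximal[of \<M>] by blast
  have sub: "subgroup M G" and KM: "K \<subseteq> M" and nM: "\<not> scalar_commutant n (\<rho> ` M)"
    using M by (auto simp: \<M>_def)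
  have "M \<noteq> carrier G" using nM schur[OF is_group irr] by auto
  then obtain g where g: "g \<in> carrier G" "g \<notin> M" and gM: "\<And>m. m \<in> M \<Longrightarrow> inv g \<otimes> m \<otimes> g \<in> M"
    using norm[OF sub KM] by blast
  obtain k where k: "g [^] (p ^ k :: nat) \<in> K" using pow[OF g(1)] by blast
  have n: "n > 0" using irr by (simp add: irreducible_representation_def)
  have q: "p ^ k > 0" "coprime (p ^ k) n" using p by (auto simp: prime_gt_0_nat prime_imp_coprime)
  have "scalar_commutant n (\<rho> ` M)"
  proof (rule scalar_commutant_normalized[OF fin n sub g(1) gM q(1) _ q(2)])
    show "scalar_commutant n (\<rho> ` S)" if "subgroup S G" "M \<subseteq> S" "g \<in> S" for S
      using max[of S] that g KM by (auto simp: \<M>_def)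
  qed (use k KM in auto)
  then show False using nM by simp
qed

end


section \<open>Tensor products\<close>

text \<open>  The row and column index \<open>a + d * i\<close> stands for the pair \<open>(a, i)\<close>, so the matrix consists of
  \<open>f * f\<close> blocks of size \<open>d\<close>, the block at \<open>(i, j)\<close> being \<open>B(i, j) A\<close>.\<close>

definition kronecker :: "nat \<Rightarrow> nat \<Rightarrow> complex mat \<Rightarrow> complex mat \<Rightarrow> complex mat" where
  "kronecker d f A B = mat (d * f) (d * f) (\<lambda>(r, s). A $$ (r mod d, s mod d) * B $$ (r div d, s div d))"

lemma kronecker_carrier [simp]: "kronecker d f A B \<in> carrier_mat (d * f) (d * f)"
  by (simp add: kronecker_def)

lemma block_index: "a < d \<Longrightarrow> i < f \<Longrightarrow> a + d * i < d * (f::nat)"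
proof -
  assume a: "a < d" and i: "i < f"
  have "a + d * i < d * Suc i" using a by simp
  also have "\<dots> \<le> d * f" using i by (intro mult_le_mono2) simp
  finally show ?thesis .
qed

lemma block_div_less: "t < d * f \<Longrightarrow> t div d < (f::nat)"
  by (simp add: less_mult_imp_div_less mult.commute)

lemma sum_blocks:
  fixes h :: "nat \<Rightarrow> 'b::comm_monoid_add"
  shows "(\<Sum>t<d * f. h t) = (\<Sum>j<f. \<Sum>c<d. h (c + d * j))"
proof (cases "d = 0")
  case False
  have "(\<Sum>j<f. \<Sum>c<d. h (c + d * j)) = (\<Sum>(j, c)\<in>{..<f} \<times> {..<d}. h (c + d * j))"
    by (rule sum.cartesian_product)
  also have "\<dots> = (\<Sum>t<d * f. h t)"
    by (rule sum.reindex_bij_witness[where i = "\<lambda>t. (t div d, t mod d)" and j = "\<lambda>(j, c). c + d * j"])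
       (use False block_div_less in \<open>auto simp: block_index\<close>)
  finally show ?thesis by simp
qed simp

lemma kronecker_index:
  "a < d \<Longrightarrow> i < f \<Longrightarrow> b < d \<Longrightarrow> j < f \<Longrightarrow>
    kronecker d f A B $$ (a + d * i, b + d * j) = A $$ (a, b) * B $$ (i, j)"
  by (simp add: kronecker_def block_index)

lemma block_eqI:
  assumes "X \<in> carrier_mat (d * f) (d * f)" "Y \<in> carrier_mat (d * f) (d * f)"
    and eq: "\<And>a b i j. a < d \<Longrightarrow> b < d \<Longrightarrow> i < f \<Longrightarrow> j < f \<Longrightarrow>
      X $$ (a + d * i, b + d * j) = Y $$ (a + d * i, b + d * j)"
  shows "X = Y"
proof (rule eq_matI)
  fix r s assume "r < dim_row Y" "s < dim_col Y"
  then have rs: "r < d * f" "s < d * f" using assms by auto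
  then have d: "d > 0" by (cases d) auto
  have "r mod d < d" "s mod d < d" "r div d < f" "s div d < f"
    using rs d by (simp_all add: less_mult_imp_div_less mult.commute)
  from eq[OF this] show "X $$ (r, s) = Y $$ (r, s)" by simp
qed (use assms in auto)

lemma kronecker_mult:
  assumes A: "A \<in> carrier_mat d d" "A' \<in> carrier_mat d d" and B: "B \<in> carrier_mat f f" "B' \<in> carrier_mat f f"
  shows "kronecker d f A B * kronecker d f A' B' = kronecker d f (A * A') (B * B')"
proof (rule block_eqI[of _ d f])
  fix a b i j assume ab: "a < d" "b < d" and ij: "i < f" "j < f"
  have "(kronecker d f A B * kronecker d f A' B') $$ (a + d * i, b + d * j)
      = (\<Sum>k<f. \<Sum>c<d. (A $$ (a, c) * B $$ (i, k)) * (A' $$ (c, b) * B' $$ (k, j)))"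
    using ab ij by (subst mult_mat_index[OF kronecker_carrier kronecker_carrier])
      (auto simp: block_index sum_blocks kronecker_index intro!: sum.cong)
  also have "\<dots> = (\<Sum>c<d. A $$ (a, c) * A' $$ (c, b)) * (\<Sum>k<f. B $$ (i, k) * B' $$ (k, j))"
    by (subst sum.swap) (simp add: sum_product mult_ac)
  also have "\<dots> = kronecker d f (A * A') (B * B') $$ (a + d * i, b + d * j)"
    using ab ij by (simp add: kronecker_index mult_mat_index[OF A] mult_mat_index[OF B] del: index_mult_mat(1))
  finally show "(kronecker d f A B * kronecker d f A' B') $$ (a + d * i, b + d * j)
      = kronecker d f (A * A') (B * B') $$ (a + d * i, b + d * j)" .
qed (rule mult_carrier_mat[OF kronecker_carrier kronecker_carrier], rule kronecker_carrier)

lemma kronecker_one: "kronecker d f (1\<^sub>m d) (1\<^sub>m f) = 1\<^sub>m (d * f)"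
proof (rule block_eqI[of _ d f])
  fix a b i j assume ab: "a < d" "b < d" and ij: "i < f" "j < f"
  have "a + d * i = b + d * j \<longleftrightarrow> a = b \<and> i = j"
  proof
    assume eq: "a + d * i = b + d * j"
    have "(a + d * i) mod d = a" "(b + d * j) mod d = b" using ab by auto
    then have "a = b" using eq by simp
    then show "a = b \<and> i = j" using eq ab by simp
  qed simp
  then show "kronecker d f (1\<^sub>m d) (1\<^sub>m f) $$ (a + d * i, b + d * j) = 1\<^sub>m (d * f) $$ (a + d * i, b + d * j)"
    using ab ij by (simp add: kronecker_index block_index)
qed auto

lemma kronecker_rep:
  assumes "matrix_rep G d \<rho>" "matrix_rep G f \<psi>"
  shows "matrix_rep G (d * f) (\<lambda>g. kronecker d f (\<rho> g) (\<psi> g))"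
proof -
  interpret \<rho>: matrix_rep G d \<rho> by fact
  interpret \<psi>: matrix_rep G f \<psi> by fact
  show ?thesis
    by (rule matrix_repI[OF \<rho>.is_group]) (simp_all add: \<rho>.rep_mult \<psi>.rep_mult kronecker_mult kronecker_one)
qed

text \<open>  Commuting with \<open>A \<otimes> 1\<close> means that every \<open>d\<close>-by-\<open>d\<close> block of \<open>X\<close> commutes with \<open>A\<close>. So all blocks are scalar,
  and their scalars form the matrix \<open>Y\<close>.\<close>

lemma kronecker_commutant_left:
  assumes sc: "scalar_commutant d S" and S: "S \<subseteq> carrier_mat d d"
    and X: "X \<in> carrier_mat (d * f) (d * f)"
    and comm: "\<And>A. A \<in> S \<Longrightarrow> kronecker d f A (1\<^sub>m f) * X = X * kronecker d f A (1\<^sub>m f)"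
  obtains Y where "Y \<in> carrier_mat f f" "X = kronecker d f (1\<^sub>m d) Y"
proof -
  define B where "B i j = mat d d (\<lambda>(a, b). X $$ (a + d * i, b + d * j))" for i j
  have Bc: "B i j \<in> carrier_mat d d" for i j by (simp add: B_def)
  have "\<exists>y. B i j = y \<cdot>\<^sub>m 1\<^sub>m d" if ij: "i < f" "j < f" for i j
  proof -
    have "A * B i j = B i j * A" if A: "A \<in> S" for A
    proof (rule eq_matI)
      have Ac: "A \<in> carrier_mat d d" using A S by auto
      fix a b assume "a < dim_row (B i j * A)" "b < dim_col (B i j * A)"
      then have ab: "a < d" "b < d" using Ac by (auto simp: B_def)
      have "(A * B i j) $$ (a, b) = (\<Sum>c<d. A $$ (a, c) * X $$ (c + d * i, b + d * j))"
        using ab by (simp add: mult_mat_index[OF Ac Bc] del: index_mult_mat(1)) (simp add: B_def)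
      also have "\<dots> = (\<Sum>k<f. if k = i then (\<Sum>c<d. A $$ (a, c) * X $$ (c + d * k, b + d * j)) else 0)"
        using ij by simp
      also have "\<dots> = (\<Sum>k<f. \<Sum>c<d. kronecker d f A (1\<^sub>m f) $$ (a + d * i, c + d * k) * X $$ (c + d * k, b + d * j))"
        using ab ij by (intro sum.cong) (auto simp: kronecker_index)
      also have "\<dots> = (kronecker d f A (1\<^sub>m f) * X) $$ (a + d * i, b + d * j)"
        using ab ij by (subst mult_mat_index[OF kronecker_carrier X]) (auto simp: block_index sum_blocks)
      also have "\<dots> = (X * kronecker d f A (1\<^sub>m f)) $$ (a + d * i, b + d * j)"
        using comm[OF A] by simp
      also have "\<dots> = (\<Sum>k<f. \<Sum>c<d. X $$ (a + d * i, c + d * k) * kronecker d f A (1\<^sub>m f) $$ (c + d * k, b + d * j))"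
        using ab ij by (subst mult_mat_index[OF X kronecker_carrier]) (auto simp: block_index sum_blocks)
      also have "\<dots> = (\<Sum>k<f. if k = j then (\<Sum>c<d. X $$ (a + d * i, c + d * k) * A $$ (c, b)) else 0)"
        using ab ij by (intro sum.cong) (auto simp: kronecker_index)
      also have "\<dots> = (\<Sum>c<d. X $$ (a + d * i, c + d * j) * A $$ (c, b))"
        using ij by simp
      also have "\<dots> = (B i j * A) $$ (a, b)"
        using ab by (simp add: mult_mat_index[OF Bc Ac] del: index_mult_mat(1)) (simp add: B_def)
      finally show "(A * B i j) $$ (a, b) = (B i j * A) $$ (a, b)" .
    qed (use A S in \<open>auto simp: B_def\<close>)
    then show ?thesis using sc Bc by (simp add: scalar_commutant_def)
  qed
  then obtain y where y: "\<And>i j. i < f \<Longrightarrow> j < f \<Longrightarrow> B i j = y i j \<cdot>\<^sub>m 1\<^sub>m d" by metis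
  define Y where "Y = mat f f (\<lambda>(i, j). y i j)"
  have "X = kronecker d f (1\<^sub>m d) Y"
  proof (rule block_eqI[OF X])
    fix a b i j assume ab: "a < d" "b < d" and ij: "i < f" "j < f"
    have "X $$ (a + d * i, b + d * j) = B i j $$ (a, b)" using ab by (simp add: B_def)
    also have "\<dots> = kronecker d f (1\<^sub>m d) Y $$ (a + d * i, b + d * j)"
      using ab ij by (simp add: y kronecker_index Y_def)
    finally show "X $$ (a + d * i, b + d * j) = kronecker d f (1\<^sub>m d) Y $$ (a + d * i, b + d * j)" .
  qed simp
  then show ?thesis using that[of Y] by (simp add: Y_def)
qed

text \<open>  Gallagher's theorem. On \<open>K\<close> the tensor product is \<open>\<rho> \<otimes> 1\<close>, so a matrix commuting with it has the form
  \<open>1 \<otimes> Y\<close>. Commuting with the whole group then forces \<open>Y\<close> to commute with \<open>\<psi>\<close>.\<close>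

lemma kronecker_irreducible:
  assumes G: "group G" and fin: "finite (carrier G)" and K: "K \<subseteq> carrier G"
    and irr: "irreducible_representation G d \<rho>" and sc: "scalar_commutant d (\<rho> ` K)"
    and irr': "irreducible_representation G f \<psi>" and triv: "\<And>k. k \<in> K \<Longrightarrow> \<psi> k = 1\<^sub>m f"
  shows "irreducible_representation G (d * f) (\<lambda>g. kronecker d f (\<rho> g) (\<psi> g))"
proof -
  interpret \<rho>: matrix_rep G d \<rho> by (rule irreducible_representation_rep[OF G irr])
  interpret \<psi>: matrix_rep G f \<psi> by (rule irreducible_representation_rep[OF G irr'])
  interpret T: matrix_rep G "d * f" "\<lambda>g. kronecker d f (\<rho> g) (\<psi> g)"
    by (rule kronecker_rep) unfold_locales
  have pos: "d > 0" "f > 0" using irr irr' by (auto simp: irreducible_representation_def)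
  show ?thesis
  proof (rule T.irreducibleI[OF fin])
    show "scalar_commutant (d * f) ((\<lambda>g. kronecker d f (\<rho> g) (\<psi> g)) ` carrier G)"
      unfolding scalar_commutant_def
    proof (intro ballI impI)
      fix X :: "complex mat" assume X: "X \<in> carrier_mat (d * f) (d * f)"
        and comm: "\<forall>A\<in>(\<lambda>g. kronecker d f (\<rho> g) (\<psi> g)) ` carrier G. A * X = X * A"
      have "kronecker d f A (1\<^sub>m f) * X = X * kronecker d f A (1\<^sub>m f)" if "A \<in> \<rho> ` K" for A
        using that comm triv K by fastforce
      moreover have "\<rho> ` K \<subseteq> carrier_mat d d" using K by auto
      ultimately obtain Y where Y: "Y \<in> carrier_mat f f" "X = kronecker d f (1\<^sub>m d) Y"
        using kronecker_commutant_left[OF sc _ X] by metis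
      have "\<psi> g * Y = Y * \<psi> g" if g: "g \<in> carrier G" for g
      proof (rule eq_matI)
        have eq: "kronecker d f (\<rho> g) (\<psi> g * Y) = kronecker d f (\<rho> g) (Y * \<psi> g)"
          using comm[rule_format, OF imageI[OF g]] g Y(1)
          by (simp add: Y(2) kronecker_mult left_mult_one_mat[OF \<rho>.rep_carrier[OF g]] right_mult_one_mat[OF \<rho>.rep_carrier[OF g]])
        have "\<rho> g \<noteq> 0\<^sub>m d d" using \<rho>.rep_det[OF g] pos by auto
        then obtain a b where ab: "a < d" "b < d" "\<rho> g $$ (a, b) \<noteq> 0"
          using \<rho>.rep_carrier[OF g] by (metis carrier_matD eq_matI index_zero_mat)
        fix i j assume "i < dim_row (Y * \<psi> g)" "j < dim_col (Y * \<psi> g)"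
        then have ij: "i < f" "j < f" using Y(1) carrier_matD[OF \<psi>.rep_carrier[OF g]] by auto
        have "\<rho> g $$ (a, b) * (\<psi> g * Y) $$ (i, j) = \<rho> g $$ (a, b) * (Y * \<psi> g) $$ (i, j)"
          using arg_cong[OF eq, of "\<lambda>Z. Z $$ (a + d * i, b + d * j)"] ab ij by (simp add: kronecker_index)
        then show "(\<psi> g * Y) $$ (i, j) = (Y * \<psi> g) $$ (i, j)" using ab by simp
      qed (use Y(1) carrier_matD[OF \<psi>.rep_carrier[OF that]] in auto)
      then obtain c where c: "Y = c \<cdot>\<^sub>m 1\<^sub>m f"
        using schur[OF G irr'] Y(1) unfolding scalar_commutant_def by auto
      have "X = c \<cdot>\<^sub>m kronecker d f (1\<^sub>m d) (1\<^sub>m f)"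
        unfolding Y(2) by (rule block_eqI[of _ d f]) (auto simp: kronecker_index c block_index carrier_matD[OF kronecker_carrier])
      then show "\<exists>c. X = c \<cdot>\<^sub>m 1\<^sub>m (d * f)" by (auto simp: kronecker_one)
    qed
  qed (use pos in simp)
qed


section \<open>Subrepresentations and the regular representation\<close>

text \<open>  If the columns of \<open>N\<close> are linearly dependent, one of them, with index \<open>j\<close>, is a combination of the others.
  \<open>E\<close> deletes it and \<open>D\<close> restores it: \<open>E D = 1 - u e / u(j)\<close>, where \<open>e\<close> is the \<open>j\<close>-th unit row.\<close>

lemma drop_column:
  fixes N :: "complex mat"
  assumes N: "N \<in> carrier_mat n (Suc m)" and u: "u \<in> carrier_vec (Suc m)" "u \<noteq> 0\<^sub>v (Suc m)" "N *\<^sub>v u = 0\<^sub>v n"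
  obtains E D where "E \<in> carrier_mat (Suc m) m" "D \<in> carrier_mat m (Suc m)" "N * (E * D) = N"
proof -
  obtain j where j: "j < Suc m" "u $ j \<noteq> 0" using u(1,2) by (auto simp: vec_eq_iff)
  define skip where "skip k = (if k < j then k else Suc k)" for k
  define E where "E = mat (Suc m) m (\<lambda>(i, k). if i = skip k then 1 else 0 :: complex)"
  define D where "D = mat m (Suc m) (\<lambda>(k, l). (if l = skip k then 1 else 0) - (if l = j then u $ skip k / u $ j else 0))"
  have Ec: "E \<in> carrier_mat (Suc m) m" and Dc: "D \<in> carrier_mat m (Suc m)" by (simp_all add: E_def D_def)
  have ED: "(E * D) $$ (i, l) = (if l = i then 1 else 0) - (if l = j then u $ i / u $ j else 0)"
    if il: "i < Suc m" "l < Suc m" for i l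
  proof -
    have "(E * D) $$ (i, l) = (\<Sum>k<m. (if i = skip k then 1 else 0) * ((if l = skip k then 1 else 0) - (if l = j then u $ skip k / u $ j else 0)))"
      using il by (simp add: mult_mat_index[OF Ec Dc] del: index_mult_mat(1)) (simp add: E_def D_def)
    also have "\<dots> = (\<Sum>k<m. if i = skip k then (if l = i then 1 else 0) - (if l = j then u $ i / u $ j else 0) else 0)"
      by (intro sum.cong) auto
    also have "\<dots> = (if l = i then 1 else 0) - (if l = j then u $ i / u $ j else 0)"
    proof (cases "i = j")
      case True
      then show ?thesis using j by (auto simp: skip_def intro!: sum.neutral)
    next
      case False
      define k0 where "k0 = (if i < j then i else i - 1)"
      have k0: "k0 < m" using il j False by (auto simp: k0_def)
      have "i = skip k \<longleftrightarrow> k = k0" for k using False by (auto simp: skip_def k0_def)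
      then show ?thesis using k0 by simp
    qed
    finally show ?thesis .
  qed
  have "N * (E * D) = N"
  proof (rule eq_matI)
    fix i l assume "i < dim_row N" "l < dim_col N"
    then have il: "i < n" "l < Suc m" using N by auto
    have nu: "(\<Sum>k<Suc m. N $$ (i, k) * u $ k) = 0"
      using arg_cong[OF u(3), of "\<lambda>v. v $ i"] il N u(1) by (simp add: scalar_prod_def lessThan_atLeast0)
    have "(N * (E * D)) $$ (i, l) = (\<Sum>k<Suc m. N $$ (i, k) * ((if l = k then 1 else 0) - (if l = j then u $ k / u $ j else 0)))"
      using il by (simp only: mult_mat_index[OF N mult_carrier_mat[OF Ec Dc]]) (intro sum.cong, auto simp: ED)
    also have "\<dots> = (\<Sum>k<Suc m. (if l = k then N $$ (i, k) else 0) - (if l = j then 1 / u $ j else 0) * (N $$ (i, k) * u $ k))"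
      by (intro sum.cong) (auto simp: algebra_simps)
    also have "\<dots> = N $$ (i, l)"
      unfolding sum_subtractf sum_distrib_left[symmetric] nu using il by simp
    finally show "(N * (E * D)) $$ (i, l) = N $$ (i, l)" .
  qed (use N Dc in auto)
  then show ?thesis using that Ec Dc by blast
qed

text \<open>  The columns of \<open>Y V\<close> are a basis of the image of \<open>Y\<close>. They are found by taking the least number \<open>m\<close> of
  columns from which \<open>Y\<close> can be recovered; a dependency among them would allow to drop one.\<close>

lemma rank_factorization:
  fixes Y :: "complex mat"
  assumes Y: "Y \<in> carrier_mat n n"
  obtains m V C where "V \<in> carrier_mat n m" "C \<in> carrier_mat m n" "Y * V * C = Y" "m \<le> n"
    "det Y = 0 \<Longrightarrow> m < n"
    "\<And>u. u \<in> carrier_vec m \<Longrightarrow> (Y * V) *\<^sub>v u = 0\<^sub>v n \<Longrightarrow> u = 0\<^sub>v m"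
proof -
  define P where "P m \<longleftrightarrow> (\<exists>V C. V \<in> carrier_mat n m \<and> C \<in> carrier_mat m n \<and> Y * V * C = Y)" for m
  have Pn: "P n" unfolding P_def using Y by (intro exI[of _ "1\<^sub>m n"]) auto
  have drop: "P m'" if V: "V \<in> carrier_mat n (Suc m')" and C: "C \<in> carrier_mat (Suc m') n" and YVC: "Y * V * C = Y"
    and u: "u \<in> carrier_vec (Suc m')" "u \<noteq> 0\<^sub>v (Suc m')" "(Y * V) *\<^sub>v u = 0\<^sub>v n" for m' V C u
  proof -
    obtain E D where E: "E \<in> carrier_mat (Suc m') m'" and D: "D \<in> carrier_mat m' (Suc m')"
      and NED: "(Y * V) * (E * D) = Y * V"
      using drop_column[OF mult_carrier_mat[OF Y V] u] by metis
    have "Y * (V * E) * (D * C) = (Y * V) * (E * D) * C"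
      using Y V C E D by (simp add: assoc_mult_mat[of _ n n _ "Suc m'" _ m'] assoc_mult_mat[of _ n n _ "m'" _ n]
        assoc_mult_mat[of _ n "Suc m'" _ m' _ n] assoc_mult_mat[of _ n n _ "Suc m'" _ n]
        assoc_mult_mat[of _ "Suc m'" m' _ "Suc m'" _ n] assoc_mult_mat[of _ n n _ "Suc m'" _ "Suc m'"]
        assoc_mult_mat[of _ n "Suc m'" _ "Suc m'" _ n])
    then have "Y * (V * E) * (D * C) = Y" using NED YVC by simp
    then show ?thesis
      unfolding P_def using mult_carrier_mat[OF V E] mult_carrier_mat[OF D C] by blast
  qed
  define m where "m = (LEAST m. P m)"
  have "P m" unfolding m_def by (rule LeastI[of P, OF Pn])
  then obtain V C where V: "V \<in> carrier_mat n m" and C: "C \<in> carrier_mat m n" and YVC: "Y * V * C = Y"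
    by (auto simp: P_def)
  have min: "m \<le> m'" if "P m'" for m' unfolding m_def using that by (rule Least_le[of P])
  have "m < n" if det: "det Y = 0"
  proof -
    obtain u where u: "u \<in> carrier_vec n" "u \<noteq> 0\<^sub>v n" "Y *\<^sub>v u = 0\<^sub>v n"
      using det_0_iff_vec_prod_zero_field[OF Y] det by auto
    obtain n' where n': "n = Suc n'" using u(1,2) by (cases n) auto
    have "P n'" using drop[of "1\<^sub>m n" n' "1\<^sub>m n" u] u Y by (simp add: n')
    then show ?thesis using min n' by fastforce
  qed
  moreover have "u = 0\<^sub>v m" if u: "u \<in> carrier_vec m" "(Y * V) *\<^sub>v u = 0\<^sub>v n" for u
  proof (rule ccontr)
    assume ne: "u \<noteq> 0\<^sub>v m"
    then obtain m' where m': "m = Suc m'" using u(1) by (cases m) auto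
    have "P m'" using drop[of V m' C u] V C YVC u ne by (simp add: m')
    then show False using min m' by fastforce
  qed
  ultimately show ?thesis using that[OF V C YVC min[OF Pn]] by blast
qed

lemma injective_mat_cancel:
  fixes B :: "complex mat"
  assumes B: "B \<in> carrier_mat n m" and inj: "\<And>u. u \<in> carrier_vec m \<Longrightarrow> B *\<^sub>v u = 0\<^sub>v n \<Longrightarrow> u = 0\<^sub>v m"
    and Z: "Z \<in> carrier_mat m l" "Z' \<in> carrier_mat m l" and eq: "B * Z = B * Z'"
  shows "Z = Z'"
proof -
  have "(Z - Z') *\<^sub>v v = 0\<^sub>v m" if v: "v \<in> carrier_vec l" for v
  proof (rule inj)
    have ZZ: "Z - Z' \<in> carrier_mat m l" using Z by auto
    show "(Z - Z') *\<^sub>v v \<in> carrier_vec m" by (rule mult_mat_vec_carrier[OF ZZ v])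
    have "B *\<^sub>v ((Z - Z') *\<^sub>v v) = (B * Z - B * Z') *\<^sub>v v"
      using B Z v ZZ by (simp flip: assoc_mult_mat_vec[OF B ZZ v] add: mult_minus_distrib_mat[OF B Z])
    also have "B * Z - B * Z' = 0\<^sub>m n l" using eq B Z by auto
    finally show "B *\<^sub>v ((Z - Z') *\<^sub>v v) = 0\<^sub>v n" using v by auto
  qed
  then have "Z - Z' = 0\<^sub>m m l"
    using Z by (intro mult_mat_vec_eq_zero_imp) auto
  then show ?thesis using Z by (auto simp: mat_eq_iff)
qed

text \<open>  The image of a matrix commuting with the representation is invariant. In the basis \<open>Y V\<close> of the image
  the action is \<open>\<tau>(g) = C \<rho>(g) V\<close>, where \<open>Y = Y V C\<close>.\<close>

lemma (in matrix_rep) image_subrepresentation: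
  assumes Y: "Y \<in> carrier_mat n n" "Y \<noteq> 0\<^sub>m n n" and comm: "\<And>g. g \<in> carrier G \<Longrightarrow> \<rho> g * Y = Y * \<rho> g"
  obtains m V \<tau> where "matrix_rep G m \<tau>" "0 < m" "m \<le> n" "det Y = 0 \<Longrightarrow> m < n" "V \<in> carrier_mat n m"
    "\<And>g. g \<in> carrier G \<Longrightarrow> \<rho> g * (Y * V) = (Y * V) * \<tau> g"
    "\<And>Z Z'. Z \<in> carrier_mat m m \<Longrightarrow> Z' \<in> carrier_mat m m \<Longrightarrow> (Y * V) * Z = (Y * V) * Z' \<Longrightarrow> Z = Z'"
proof -
  obtain m V C where V: "V \<in> carrier_mat n m" and C: "C \<in> carrier_mat m n" and YVC: "Y * V * C = Y"
    and mn: "m \<le> n" "det Y = 0 \<Longrightarrow> m < n"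
    and inj: "\<And>u. u \<in> carrier_vec m \<Longrightarrow> (Y * V) *\<^sub>v u = 0\<^sub>v n \<Longrightarrow> u = 0\<^sub>v m"
    using rank_factorization[OF Y(1)] by metis
  define B where "B = Y * V"
  have B: "B \<in> carrier_mat n m" using Y(1) V by (auto simp: B_def)
  have cancel: "Z = Z'" if "Z \<in> carrier_mat m m" "Z' \<in> carrier_mat m m" "B * Z = B * Z'" for Z Z'
    using injective_mat_cancel[OF B _ that] inj by (simp add: B_def)
  define \<tau> where "\<tau> g = C * (\<rho> g * V)" for g
  have \<tau>c: "\<tau> g \<in> carrier_mat m m" if "g \<in> carrier G" for g
    using C mult_carrier_mat[OF rep_carrier[OF that] V] by (simp add: \<tau>_def mult_carrier_mat)
  have BC: "B * C = Y" using YVC by (simp add: B_def)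
  have twine: "\<rho> g * B = B * \<tau> g" if g: "g \<in> carrier G" for g
  proof -
    have r: "\<rho> g \<in> carrier_mat n n" using g by simp
    have "\<rho> g * B = Y * (\<rho> g * V)"
      unfolding B_def using comm[OF g] assoc_mult_mat[OF r Y(1) V] assoc_mult_mat[OF Y(1) r V] by simp
    also have "\<dots> = B * \<tau> g"
      unfolding \<tau>_def using assoc_mult_mat[OF B C mult_carrier_mat[OF r V]] BC by simp
    finally show ?thesis .
  qed
  have m0: "0 < m"
  proof (rule ccontr)
    assume "\<not> 0 < m"
    then have "B * C = 0\<^sub>m n n" using B C by (intro eq_matI) (auto simp: scalar_prod_def)
    then show False using BC Y(2) by simp
  qed
  have "matrix_rep G m \<tau>"
  proof (rule matrix_repI[OF is_group \<tau>c])
    show "\<tau> (g \<otimes> h) = \<tau> g * \<tau> h" if g: "g \<in> carrier G" and h: "h \<in> carrier G" for g h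
    proof (rule cancel)
      have "B * \<tau> (g \<otimes> h) = \<rho> g * (\<rho> h * B)"
        using twine[of "g \<otimes> h"] g h assoc_mult_mat[OF rep_carrier[OF g] rep_carrier[OF h] B] by (simp add: rep_mult)
      also have "\<dots> = \<rho> g * B * \<tau> h"
        using twine[OF h] assoc_mult_mat[OF rep_carrier[OF g] B \<tau>c[OF h]] by simp
      also have "\<dots> = B * (\<tau> g * \<tau> h)"
        using twine[OF g] assoc_mult_mat[OF B \<tau>c[OF g] \<tau>c[OF h]] by simp
      finally show "B * \<tau> (g \<otimes> h) = B * (\<tau> g * \<tau> h)" .
    qed (use \<tau>c g h in \<open>auto intro: mult_carrier_mat\<close>)
    show "\<tau> \<one> = 1\<^sub>m m"
    proof (rule cancel)
      show "B * \<tau> \<one> = B * 1\<^sub>m m" using twine[of \<one>] B by simp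
    qed (use \<tau>c in auto)
  qed
  then show ?thesis using that[of m \<tau> V] m0 mn V twine cancel by (simp add: B_def)
qed

lemma regular_representation:
  assumes H: "group H" and fin: "finite (carrier H)"
  obtains N R where "matrix_rep H N R" "\<And>h. h \<in> carrier H \<Longrightarrow> R h = 1\<^sub>m N \<Longrightarrow> h = \<one>\<^bsub>H\<^esub>"
proof -
  interpret group H by (rule H)
  obtain e where e: "bij_betw e {..<card (carrier H)} (carrier H)"
    using ex_bij_betw_nat_finite[OF fin] by (auto simp: lessThan_atLeast0)
  define N where "N = card (carrier H)"
  define R where "R h = mat N N (\<lambda>(i, j). if e i = h \<otimes>\<^bsub>H\<^esub> e j then 1 else 0 :: complex)" for h
  have eH: "e i \<in> carrier H" if "i < N" for i using e that by (auto simp: N_def bij_betw_def)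
  have inj: "e i = e j \<longleftrightarrow> i = j" if "i < N" "j < N" for i j
    using e that by (auto simp: N_def bij_betw_def inj_on_def)
  have ex: "\<exists>k<N. e k = x" if "x \<in> carrier H" for x
    using e that unfolding bij_betw_def N_def by (metis imageE lessThan_iff)
  have Rc: "R h \<in> carrier_mat N N" for h by (simp add: R_def)
  have "matrix_rep H N R"
  proof (rule matrix_repI[OF H Rc])
    fix g h assume g: "g \<in> carrier H" and h: "h \<in> carrier H"
    show "R (g \<otimes>\<^bsub>H\<^esub> h) = R g * R h"
    proof (rule eq_matI)
      fix i j assume "i < dim_row (R g * R h)" "j < dim_col (R g * R h)"
      then have ij: "i < N" "j < N" by (auto simp: R_def)
      obtain k0 where k0: "k0 < N" "e k0 = h \<otimes>\<^bsub>H\<^esub> e j" using ex h eH[OF ij(2)] by blast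
      have k: "e k = h \<otimes>\<^bsub>H\<^esub> e j \<longleftrightarrow> k = k0" if "k < N" for k using that inj[of k k0] k0 by auto
      have "(R g * R h) $$ (i, j) = (\<Sum>k<N. R g $$ (i, k) * R h $$ (k, j))"
        using ij by (intro mult_mat_index[OF Rc Rc])
      also have "\<dots> = (\<Sum>k<N. if k = k0 then R g $$ (i, k) else 0)"
        using ij k by (intro sum.cong) (auto simp: R_def)
      also have "\<dots> = R g $$ (i, k0)" using k0 by simp
      also have "\<dots> = R (g \<otimes>\<^bsub>H\<^esub> h) $$ (i, j)"
        using ij k0 g h eH by (simp add: R_def m_assoc)
      finally show "R (g \<otimes>\<^bsub>H\<^esub> h) $$ (i, j) = (R g * R h) $$ (i, j)" by simp
    qed (simp_all add: R_def)
  next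
    show "R \<one>\<^bsub>H\<^esub> = 1\<^sub>m N"
      by (rule eq_matI) (auto simp: R_def eH inj)
  qed
  moreover have "h = \<one>\<^bsub>H\<^esub>" if h: "h \<in> carrier H" and R1: "R h = 1\<^sub>m N" for h
  proof -
    obtain k where k: "k < N" "e k = \<one>\<^bsub>H\<^esub>" using ex by blast
    have "R h $$ (k, k) = 1" using R1 k by simp
    then show ?thesis using k h by (auto simp: R_def split: if_splits)
  qed
  ultimately show ?thesis using that by blast
qed


section \<open>An irreducible representation with a scalar commutator\<close>

lemma (in matrix_rep) commutator_det:
  assumes "x \<in> carrier G" "y \<in> carrier G"
  shows "det (\<rho> (commutator G x y)) = 1"
proof -
  have mult: "det (\<rho> (g \<otimes> h)) = det (\<rho> g) * det (\<rho> h)" if "g \<in> carrier G" "h \<in> carrier G" for g h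
    using that det_mult[OF rep_carrier rep_carrier] by (simp add: rep_mult)
  have "det (\<rho> (commutator G x y)) = (det (\<rho> x) * det (\<rho> (inv x))) * (det (\<rho> y) * det (\<rho> (inv y)))"
    using assms by (simp add: commutator_def mult mult_ac)
  then show ?thesis using rep_det assms by simp
qed

text \<open>  As \<open>c = [x, y]\<close> acts nontrivially in the regular representation of \<open>G/K\<close>, with finite order, and is
  central modulo \<open>K\<close>, it has an eigenvalue \<open>\<zeta> \<noteq> 1\<close> whose eigenspace is invariant. So there are representations
  of \<open>G/K\<close> in which \<open>c\<close> acts as the scalar \<open>\<zeta>\<close>, and one of least degree is irreducible: a nonscalar matrix
  in its commutant, shifted by an eigenvalue, would have a smaller nonzero image on which \<open>c\<close> still acts
  as \<open>\<zeta>\<close>. Its degree \<open>n\<close> satisfies \<open>\<zeta> ^ n = 1\<close> since \<open>c\<close> has determinant \<open>1\<close>.\<close>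

lemma commutator_scalar_irreducible:
  fixes G (structure)
  assumes G: "group G" and fin: "finite (carrier G)" and K: "K \<lhd> G"
    and xy: "x \<in> carrier G" "y \<in> carrier G" and cK: "commutator G x y \<notin> K"
    and central: "commutator G x y \<in> center_mod G K"
    and q: "q > 0" "commutator G x y [^] (q::nat) \<in> K"
  obtains n \<psi> \<zeta> where "irreducible_representation G n \<psi>" "\<And>k. k \<in> K \<Longrightarrow> \<psi> k = 1\<^sub>m n"
    "\<zeta> ^ q = 1" "\<zeta> \<noteq> 1" "(\<zeta>::complex) ^ n = 1"
proof -
  interpret normal K G by (rule K)
  have Kc: "k \<in> carrier G" if "k \<in> K" for k using that by (rule mem_carrier)
  define c where "c = commutator G x y"
  have cc: "c \<in> carrier G" using xy by (simp add: c_def)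
  obtain N R where R: "matrix_rep (G Mod K) N R"
    and faithful: "\<And>h. h \<in> carrier (G Mod K) \<Longrightarrow> R h = 1\<^sub>m N \<Longrightarrow> h = \<one>\<^bsub>G Mod K\<^esub>"
  proof (rule regular_representation)
    show "group (G Mod K)" by (rule factorgroup_is_group)
    show "finite (carrier (G Mod K))" using fin by (simp add: carrier_FactGroup)
  qed blast
  interpret R: matrix_rep "G Mod K" N R by (rule R)
  define \<rho> where "\<rho> g = R (K #> g)" for g
  have coset: "K #> g \<in> carrier (G Mod K)" if "g \<in> carrier G" for g
    using that by (simp add: carrier_FactGroup)
  have rep: "matrix_rep G N \<rho>"
  proof (rule matrix_repI[OF G])
    show "\<rho> g \<in> carrier_mat N N" if "g \<in> carrier G" for g
      using coset[OF that] by (simp add: \<rho>_def)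
    show "\<rho> (g \<otimes> h) = \<rho> g * \<rho> h" if "g \<in> carrier G" "h \<in> carrier G" for g h
      using R.rep_mult[OF coset coset] that by (simp add: \<rho>_def rcos_sum)
    show "\<rho> \<one> = 1\<^sub>m N"
      using R.rep_one subset by (simp add: \<rho>_def)
  qed
  interpret \<rho>: matrix_rep G N \<rho> by (rule rep)
  have \<rho>K: "\<rho> k = 1\<^sub>m N" if "k \<in> K" for k
    using R.rep_one rcos_const[OF is_group that] by (simp add: \<rho>_def)
  have \<rho>c: "\<rho> c \<noteq> 1\<^sub>m N"
  proof
    assume "\<rho> c = 1\<^sub>m N"
    then have "K #> c = K" using faithful[OF coset[OF cc]] by (simp add: \<rho>_def)
    then show False using cK rcos_self[OF cc subgroup_axioms] by (simp add: c_def)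
  qed
  have comm: "\<rho> g * \<rho> c = \<rho> c * \<rho> g" if g: "g \<in> carrier G" for g
  proof -
    have "commutator G c g \<in> K" using central g unfolding c_def center_mod_def by blast
    then have "\<rho> (c \<otimes> g) = \<rho> (g \<otimes> c)"
      using \<rho>.rep_mult[of "commutator G c g" "g \<otimes> c"] \<rho>K commutator_mult[OF cc g] g cc
      by (simp add: left_mult_one_mat[OF \<rho>.rep_carrier])
    then show ?thesis using g cc by (simp add: \<rho>.rep_mult)
  qed
  have A: "\<rho> c \<in> carrier_mat N N" using cc by simp
  have one: "1\<^sub>m N ^\<^sub>m i = (1\<^sub>m N :: complex mat)" for i by (induction i) auto
  have Ai: "\<rho> c ^\<^sub>m i * 1\<^sub>m N * 1\<^sub>m N ^\<^sub>m i = \<rho> (c [^] i)" for i :: nat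
    using cc by (simp add: one \<rho>.rep_pow right_mult_one_mat[OF \<rho>.rep_carrier])
  obtain \<zeta> F where \<zeta>: "\<zeta> ^ q = 1" "\<zeta> \<noteq> 1" and F: "F \<in> carrier_mat N N" "F \<noteq> 0\<^sub>m N N"
    and cF: "\<rho> c * F * 1\<^sub>m N = \<zeta> \<cdot>\<^sub>m F"
    and Fcomm: "\<And>C D. C \<in> carrier_mat N N \<Longrightarrow> D \<in> carrier_mat N N \<Longrightarrow>
        (\<And>i. C * (\<rho> c ^\<^sub>m i * 1\<^sub>m N * 1\<^sub>m N ^\<^sub>m i) = (\<rho> c ^\<^sub>m i * 1\<^sub>m N * 1\<^sub>m N ^\<^sub>m i) * D) \<Longrightarrow> C * F = F * D"
  proof (rule conj_eigenmatrix[OF A one_carrier_mat one_carrier_mat q(1)])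
    show "\<rho> c ^\<^sub>m q * 1\<^sub>m N * 1\<^sub>m N ^\<^sub>m q = 1\<^sub>m N" using Ai \<rho>K[OF q(2)] by (simp add: c_def)
    show "\<rho> c * 1\<^sub>m N * 1\<^sub>m N \<noteq> 1\<^sub>m N" using \<rho>c A by simp
  qed blast
  have gF: "\<rho> g * F = F * \<rho> g" if g: "g \<in> carrier G" for g
  proof (rule Fcomm)
    fix i :: nat
    have "\<rho> g * \<rho> (c [^] i) = \<rho> (c [^] i) * \<rho> g"
    proof (induction i)
      case 0
      show ?case using g by (simp add: left_mult_one_mat[OF \<rho>.rep_carrier] right_mult_one_mat[OF \<rho>.rep_carrier])
    next
      case (Suc i)
      have ci: "c [^] i \<in> carrier G" using cc by simp
      have "\<rho> g * \<rho> (c [^] Suc i) = \<rho> g * \<rho> (c [^] i) * \<rho> c"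
        using assoc_mult_mat[OF \<rho>.rep_carrier[OF g] \<rho>.rep_carrier[OF ci] A] cc by (simp add: \<rho>.rep_mult)
      also have "\<dots> = \<rho> (c [^] i) * (\<rho> g * \<rho> c)"
        unfolding Suc by (rule assoc_mult_mat[OF \<rho>.rep_carrier[OF ci] \<rho>.rep_carrier[OF g] A])
      also have "\<dots> = \<rho> (c [^] Suc i) * \<rho> g"
        unfolding comm[OF g] using assoc_mult_mat[OF \<rho>.rep_carrier[OF ci] A \<rho>.rep_carrier[OF g]] cc
        by (simp add: \<rho>.rep_mult)
      finally show ?case .
    qed
    then show "\<rho> g * (\<rho> c ^\<^sub>m i * 1\<^sub>m N * 1\<^sub>m N ^\<^sub>m i) = \<rho> c ^\<^sub>m i * 1\<^sub>m N * 1\<^sub>m N ^\<^sub>m i * \<rho> g"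
      unfolding Ai .
  qed (use g in auto)
  define Q where "Q m \<longleftrightarrow> 0 < m \<and> (\<exists>\<tau>. matrix_rep G m \<tau> \<and> (\<forall>k\<in>K. \<tau> k = 1\<^sub>m m) \<and> \<tau> c = \<zeta> \<cdot>\<^sub>m 1\<^sub>m m)" for m
  have "\<exists>m. Q m"
  proof -
    obtain m V \<tau> where \<tau>: "matrix_rep G m \<tau>" and m: "0 < m" and V: "V \<in> carrier_mat N m"
      and tw: "\<And>g. g \<in> carrier G \<Longrightarrow> \<rho> g * (F * V) = (F * V) * \<tau> g"
      and cancel: "\<And>Z Z'. Z \<in> carrier_mat m m \<Longrightarrow> Z' \<in> carrier_mat m m \<Longrightarrow> (F * V) * Z = (F * V) * Z' \<Longrightarrow> Z = Z'"
      using \<rho>.image_subrepresentation[OF F gF] by metis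
    interpret \<tau>: matrix_rep G m \<tau> by (rule \<tau>)
    have B: "F * V \<in> carrier_mat N m" using F V by auto
    have "\<tau> k = 1\<^sub>m m" if k: "k \<in> K" for k
    proof (rule cancel)
      show "F * V * \<tau> k = F * V * 1\<^sub>m m"
        using tw[OF Kc[OF k]] \<rho>K[OF k] left_mult_one_mat[OF B] right_mult_one_mat[OF B] by simp
    qed (use Kc[OF k] in auto)
    moreover have "\<tau> c = \<zeta> \<cdot>\<^sub>m 1\<^sub>m m"
    proof (rule cancel)
      have "F * V * \<tau> c = \<rho> c * F * V" using tw[OF cc] assoc_mult_mat[OF A F(1) V] by simp
      also have "\<dots> = \<zeta> \<cdot>\<^sub>m (F * V)"
        using cF right_mult_one_mat[OF mult_carrier_mat[OF A F(1)]] mult_smult_assoc_mat[OF F(1) V] by simp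
      also have "\<dots> = F * V * (\<zeta> \<cdot>\<^sub>m 1\<^sub>m m)"
        using mult_smult_distrib[OF B one_carrier_mat[of m]] right_mult_one_mat[OF B] by simp
      finally show "F * V * \<tau> c = F * V * (\<zeta> \<cdot>\<^sub>m 1\<^sub>m m)" .
    qed (use cc in auto)
    ultimately show ?thesis using \<tau> m unfolding Q_def by blast
  qed
  define n where "n = (LEAST m. Q m)"
  have "Q n" unfolding n_def by (rule LeastI_ex[of Q]) fact
  then obtain \<psi> where n: "0 < n" and \<psi>: "matrix_rep G n \<psi>" and \<psi>K: "\<And>k. k \<in> K \<Longrightarrow> \<psi> k = 1\<^sub>m n"
    and \<psi>c: "\<psi> c = \<zeta> \<cdot>\<^sub>m 1\<^sub>m n"
    by (auto simp: Q_def)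
  have min: "n \<le> m" if "Q m" for m unfolding n_def using that by (rule Least_le[of Q])
  interpret \<psi>: matrix_rep G n \<psi> by (rule \<psi>)
  have "scalar_commutant n (\<psi> ` carrier G)"
    unfolding scalar_commutant_def
  proof (intro ballI impI)
    fix X :: "complex mat" assume X: "X \<in> carrier_mat n n" and Xc: "\<forall>A\<in>\<psi> ` carrier G. A * X = X * A"
    obtain k where k: "det (X - k \<cdot>\<^sub>m 1\<^sub>m n) = 0" using singular_shift[OF X n] .
    let ?Y = "X - k \<cdot>\<^sub>m 1\<^sub>m n"
    have Y: "?Y \<in> carrier_mat n n" by (rule minus_carrier_mat) simp
    have Yc: "\<psi> g * ?Y = ?Y * \<psi> g" if g: "g \<in> carrier G" for g
      using Xc g X by (simp add: minus_mult_distrib_mat[of _ n n _ _ n] mult_minus_distrib_mat[of _ n n _ n]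
        mult_smult_distrib[of _ n n _ n] mult_smult_assoc_mat[of _ n n _ n]
        left_mult_one_mat[OF \<psi>.rep_carrier[OF g]] right_mult_one_mat[OF \<psi>.rep_carrier[OF g]])
    have "?Y = 0\<^sub>m n n"
    proof (rule ccontr)
      assume "?Y \<noteq> 0\<^sub>m n n"
      then obtain m V \<tau> where \<tau>: "matrix_rep G m \<tau>" and m: "0 < m" "m < n" and V: "V \<in> carrier_mat n m"
        and tw: "\<And>g. g \<in> carrier G \<Longrightarrow> \<psi> g * (?Y * V) = (?Y * V) * \<tau> g"
        and cancel: "\<And>Z Z'. Z \<in> carrier_mat m m \<Longrightarrow> Z' \<in> carrier_mat m m \<Longrightarrow> (?Y * V) * Z = (?Y * V) * Z' \<Longrightarrow> Z = Z'"
        using \<psi>.image_subrepresentation[OF Y _ Yc] k by metis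
      interpret \<tau>: matrix_rep G m \<tau> by (rule \<tau>)
      define B where "B = ?Y * V"
      have B: "B \<in> carrier_mat n m" using Y V by (simp add: B_def mult_carrier_mat[OF Y V])
      have "\<tau> k = 1\<^sub>m m" if k: "k \<in> K" for k
      proof (rule cancel, unfold B_def[symmetric])
        show "B * \<tau> k = B * 1\<^sub>m m"
          using tw[OF Kc[OF k]] \<psi>K[OF k] B by (simp flip: B_def)
      qed (use Kc[OF k] in auto)
      moreover have "\<tau> c = \<zeta> \<cdot>\<^sub>m 1\<^sub>m m"
      proof (rule cancel, unfold B_def[symmetric])
        have "B * \<tau> c = \<zeta> \<cdot>\<^sub>m B"
          using tw[OF cc] \<psi>c mult_smult_assoc_mat[OF one_carrier_mat B, of \<zeta>] B by (simp flip: B_def)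
        then show "B * \<tau> c = B * (\<zeta> \<cdot>\<^sub>m 1\<^sub>m m)"
          using mult_smult_distrib[OF B one_carrier_mat[of m]] right_mult_one_mat[OF B] by simp
      qed (use cc in auto)
      ultimately have "Q m" using \<tau> m unfolding Q_def by blast
      then show False using min m(2) by fastforce
    qed
    then have "X = k \<cdot>\<^sub>m 1\<^sub>m n"
      using X by (auto simp: mat_eq_iff)
    then show "\<exists>c. X = c \<cdot>\<^sub>m 1\<^sub>m n" by blast
  qed
  then have irr: "irreducible_representation G n \<psi>" by (rule \<psi>.irreducibleI[OF fin n])
  have "\<zeta> ^ n = 1" using \<psi>.commutator_det[OF xy] \<psi>c by (simp flip: c_def)
  then show ?thesis using that[OF irr \<psi>K \<zeta>] by blast
qed


section \<open>The prime divisor complex is a cone\<close>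

lemma cd_iff:
  assumes "group G"
  shows "d \<in> cd G \<longleftrightarrow> (\<exists>\<rho>. irreducible_representation G d \<rho>)"
proof -
  interpret group G by fact
  have "character G \<rho> \<one>\<^bsub>G\<^esub> = of_nat n" if "irreducible_representation G n \<rho>" for n \<rho>
  proof -
    interpret matrix_rep G n \<rho> by (rule irreducible_representation_rep[OF assms that])
    show ?thesis by (simp add: character_def mat_trace_def)
  qed
  then show ?thesis unfolding cd_def Irr_def by (force simp: of_nat_eq_iff)
qed

text \<open>  The degree \<open>f\<close> belongs to a representation of \<open>G/K\<close> in which a commutator acts as a \<open>p\<close>-power root of unity
  \<open>\<zeta> \<noteq> 1\<close>; then \<open>\<zeta> ^ f = 1\<close> forces \<open>p\<close> to divide \<open>f\<close>.\<close>

lemma degree_multiple_of_prime: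
  fixes G (structure)
  assumes G: "group G" and fin: "finite (carrier G)" and K: "maximal_nonabelian_quotient G K"
    and p: "normalization_semidom_class.prime (p::nat)" and pK: "p_group p (G Mod K)"
  obtains f where "f \<in> cd G" "p dvd f" "f \<noteq> 1"
    and "\<And>d. d \<in> cd G \<Longrightarrow> \<not> p dvd d \<Longrightarrow> d * f \<in> cd G"
proof -
  have KG: "K \<lhd> G" and nc: "\<not> comm_group (G Mod K)"
    and max: "\<And>N. N \<lhd> G \<Longrightarrow> \<not> comm_group (G Mod N) \<Longrightarrow> K \<subseteq> N \<Longrightarrow> N = K"
    using K by (auto simp: maximal_nonabelian_quotient_def)
  interpret K: normal K G by (rule KG)
  interpret Q: group "G Mod K" by (rule K.factorgroup_is_group)
  obtain k where ord: "Coset.order (G Mod K) = p ^ k" using pK by (auto simp: p_group_def)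
  have pow: "g [^] (p ^ k) \<in> K" if g: "g \<in> carrier G" for g
  proof -
    have "(K #> g) [^]\<^bsub>G Mod K\<^esub> (p ^ k) = \<one>\<^bsub>G Mod K\<^esub>"
      using Q.pow_order_eq_1[of "K #> g"] g ord by (simp add: carrier_FactGroup)
    then show ?thesis using K.FactGroup_pow[OF g] K.coset_eq_H_iff g by simp
  qed
  define Z where "Z = center_mod G K"
  have Zn: "Z \<lhd> G" and KZ: "K \<subseteq> Z" using K.center_mod_normal K.subset_center_mod by (simp_all add: Z_def)
  interpret Z: normal Z G by (rule Zn)
  have "carrier (G Mod K) \<noteq> {\<one>\<^bsub>G Mod K\<^esub>}"
    using nc Q.comm_group_iff_commutators by (metis Q.commutator_closed singletonD)
  then obtain z where z: "z \<in> group_center (G Mod K)" "z \<noteq> \<one>\<^bsub>G Mod K\<^esub>"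
    using Q.p_group_center_nontrivial[OF p ord] by blast
  then obtain z0 where z0: "z0 \<in> carrier G" "z = K #> z0"
    by (auto simp: group_center_def carrier_FactGroup)
  have z0Z: "z0 \<in> Z" "z0 \<notin> K"
    using K.center_mod_iff[OF z0(1)] K.coset_eq_H_iff[OF z0(1)] z z0(2) by (simp_all add: Z_def)
  then have "comm_group (G Mod Z)" using max[OF Zn _ KZ] by blast
  then have comZ: "commutator G x y \<in> Z" if "x \<in> carrier G" "y \<in> carrier G" for x y
    using Z.comm_group_Mod_iff that by blast
  obtain x y where xy: "x \<in> carrier G" "y \<in> carrier G" "commutator G x y \<notin> K"
    using nc K.comm_group_Mod_iff by blast
  have norm: "\<exists>g\<in>carrier G - M. \<forall>m\<in>M. inv g \<otimes> m \<otimes> g \<in> M"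
    if M: "subgroup M G" and KM: "K \<subseteq> M" and ne: "M \<noteq> carrier G" for M
  proof -
    interpret M: subgroup M G by (rule M)
    have conj: "inv g \<otimes> m \<otimes> g \<in> M" if g: "g \<in> carrier G" and m: "m \<in> M" and c: "commutator G (inv g) m \<in> M" for g m
    proof -
      have "inv g \<otimes> m \<otimes> g = commutator G (inv g) m \<otimes> m"
        using g M.mem_carrier[OF m] by (simp add: commutator_def K.m_assoc)
      then show ?thesis using c m by simp
    qed
    \<comment> \<open>Subgroups above \<open>Z\<close> are normal because \<open>G/Z\<close> is abelian; the others are normalized by \<open>Z\<close>, as \<open>[Z, G] \<subseteq> K \<subseteq> M\<close>.\<close>
    show ?thesis
    proof (cases "Z \<subseteq> M")
      case True
      obtain g where g: "g \<in> carrier G - M" using ne M.subset by blast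
      have "inv g \<otimes> m \<otimes> g \<in> M" if m: "m \<in> M" for m
        using conj[of g m] comZ[of "inv g" m] True g m M.mem_carrier[OF m] by blast
      then show ?thesis using g by blast
    next
      case False
      then obtain g where g: "g \<in> Z" "g \<notin> M" by blast
      have gc: "g \<in> carrier G" using g(1) by (rule Z.mem_carrier)
      have "inv g \<in> center_mod G K" using subgroup.m_inv_closed[OF Z.subgroup_axioms g(1)] by (simp add: Z_def)
      then have "inv g \<otimes> m \<otimes> g \<in> M" if m: "m \<in> M" for m
        using conj[OF gc m] M.mem_carrier[OF m] KM by (auto simp: center_mod_def)
      then show ?thesis using g gc by blast
    qed
  qed
  let ?c = "commutator G x y"
  obtain n \<psi> \<zeta> where \<psi>: "irreducible_representation G n \<psi>" and \<psi>K: "\<And>k. k \<in> K \<Longrightarrow> \<psi> k = 1\<^sub>m n"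
    and \<zeta>: "\<zeta> ^ (p ^ k) = 1" "\<zeta> \<noteq> 1" "(\<zeta>::complex) ^ n = 1"
  proof (rule commutator_scalar_irreducible[OF G fin KG xy])
    show "?c \<in> center_mod G K" using comZ[OF xy(1,2)] by (simp add: Z_def)
    show "0 < p ^ k" using p by (simp add: prime_gt_0_nat)
    show "?c [^] (p ^ k) \<in> K" using pow xy by simp
  qed blast
  have pn: "p dvd n"
  proof (rule ccontr)
    assume "\<not> p dvd n"
    then have "coprime (p ^ k) n" using p by (simp add: prime_imp_coprime)
    then show False using root_of_unity_coprime_exponents[OF \<zeta>(1,3)] \<zeta>(2) p by (simp add: prime_gt_0_nat)
  qed
  have prod: "d * n \<in> cd G" if d: "d \<in> cd G" and pd: "\<not> p dvd d" for d
  proof -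
    obtain \<rho> where \<rho>: "irreducible_representation G d \<rho>" using d cd_iff[OF G] by blast
    interpret \<rho>: matrix_rep G d \<rho> by (rule irreducible_representation_rep[OF G \<rho>])
    have "scalar_commutant d (\<rho> ` K)"
      using \<rho>.scalar_commutant_restrict[OF fin \<rho> K.is_subgroup p pd norm] pow by blast
    then show ?thesis
      using kronecker_irreducible[OF G fin K.subset \<rho> _ \<psi> \<psi>K] cd_iff[OF G] by blast
  qed
  have "n \<noteq> 1" using pn p by (auto simp: prime_nat_iff)
  moreover have "n \<in> cd G" using \<psi> cd_iff[OF G] by blast
  ultimately show ?thesis using that pn prod by blast
qed

lemma prime_divisor_complex_cone:
  assumes G: "group G" and fin: "finite (carrier G)" and K: "maximal_nonabelian_quotient G K"
    and p: "normalization_semidom_class.prime (p::nat)" and pK: "p_group p (G Mod K)"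
  shows "{p} \<in> prime_divisor_complex G"
    and "Q \<in> prime_divisor_complex G \<Longrightarrow> insert p Q \<in> prime_divisor_complex G"
proof -
  obtain f where f: "f \<in> cd G" "p dvd f" "f \<noteq> 1"
    and prod: "\<And>d. d \<in> cd G \<Longrightarrow> \<not> p dvd d \<Longrightarrow> d * f \<in> cd G"
    using degree_multiple_of_prime[OF assms] by metis
  have pdeg: "p \<in> degree_primes G" using p f by (auto simp: degree_primes_def)
  show "{p} \<in> prime_divisor_complex G" using pdeg f by (auto simp: prime_divisor_complex_def)
  assume Q: "Q \<in> prime_divisor_complex G"
  then obtain d where d: "d \<in> cd G" "\<forall>q\<in>Q. q dvd d" and Qs: "Q \<subseteq> degree_primes G"
    by (auto simp: prime_divisor_complex_def)
  have "\<exists>e\<in>cd G. p dvd e \<and> d dvd e"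
    using prod[OF d(1)] d(1) f(2) by (metis dvd_mult dvd_refl dvd_triv_left)
  then show "insert p Q \<in> prime_divisor_complex G"
    using pdeg Qs d(2) unfolding prime_divisor_complex_def by (auto intro: dvd_trans)
qed


section \<open>Nilpotent groups\<close>

lemma (in group) lower_central_series_subset: "lower_central_series G n \<subseteq> carrier G"
proof (induction n)
  case (Suc n)
  then show ?case by (auto intro!: generate_incl)
qed simp

text \<open>  The last term of the lower central series that is not contained in \<open>H\<close> is central modulo \<open>H\<close>.\<close>

lemma (in normal) nilpotent_center_mod:
  assumes nil: "nilpotent_group G" and ne: "H \<noteq> carrier G"
  shows "\<exists>z\<in>center_mod G H. z \<notin> H"
proof -
  obtain n where n: "lower_central_series G n = {\<one>}" using nil by (auto simp: nilpotent_group_def)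
  then have ex: "lower_central_series G n \<subseteq> H" by simp
  define m where "m = (LEAST m. lower_central_series G m \<subseteq> H)"
  have m: "lower_central_series G m \<subseteq> H" unfolding m_def using ex by (rule LeastI)
  obtain m' where m': "m = Suc m'"
    using m ne subset by (cases m) auto
  have "\<not> lower_central_series G m' \<subseteq> H"
    using not_less_Least[of m' "\<lambda>m. lower_central_series G m \<subseteq> H"] m' by (simp add: m_def)
  then obtain z where z: "z \<in> lower_central_series G m'" "z \<notin> H" by blast
  have zc: "z \<in> carrier G" using z(1) lower_central_series_subset by blast
  have "commutator G z g \<in> H" if g: "g \<in> carrier G" for g
  proof -
    have "commutator G z g \<in> lower_central_series G (Suc m')"
      using z(1) g unfolding lower_central_series.simps commutator_def by (intro generate.incl) blast
    then show ?thesis using m m' by blast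
  qed
  then show ?thesis using z zc by (auto simp: center_mod_def)
qed

lemma maximal_nonabelian_quotient_exists:
  assumes G: "group G" and fin: "finite (carrier G)" and nc: "\<not> comm_group G"
  obtains K where "maximal_nonabelian_quotient G K"
proof -
  interpret group G by (rule G)
  let ?N = "{N. N \<lhd> G \<and> \<not> comm_group (G Mod N)}"
  have "?N \<subseteq> Pow (carrier G)" using normal_imp_subgroup subgroup.subset by blast
  then have "finite ?N" using fin by (simp add: finite_subset)
  moreover have "{\<one>\<^bsub>G\<^esub>} \<in> ?N"
    using one_is_normal normal.comm_group_Mod_iff[OF one_is_normal] nc comm_group_iff_commutators by auto
  ultimately obtain K where "K \<in> ?N" "\<And>N. N \<in> ?N \<Longrightarrow> K \<subseteq> N \<Longrightarrow> K = N"
    using finite_has_maximal[of ?N] by blast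
  then show ?thesis using that[of K] unfolding maximal_nonabelian_quotient_def by blast
qed

lemma nilpotent_maximal_nonabelian_quotient_p_group:
  assumes fin: "finite (carrier G)" and nil: "nilpotent_group G"
    and K: "maximal_nonabelian_quotient G K"
  obtains p :: nat where "normalization_semidom_class.prime p" "p_group p (G Mod K)"
proof -
  have KG: "K \<lhd> G" and nc: "\<not> comm_group (G Mod K)"
    and max: "\<And>N. N \<lhd> G \<Longrightarrow> \<not> comm_group (G Mod N) \<Longrightarrow> K \<subseteq> N \<Longrightarrow> N = K"
    using K by (auto simp: maximal_nonabelian_quotient_def)
  interpret K: normal K G by (rule KG)
  interpret Q: group "G Mod K" by (rule K.factorgroup_is_group)
  have "K \<noteq> carrier G"
    using nc K.comm_group_Mod_iff by auto
  then obtain z where z: "z \<in> center_mod G K" "z \<notin> K" using K.nilpotent_center_mod[OF nil] by blast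
  have zc: "z \<in> carrier G" using z(1) by (simp add: center_mod_def)
  have min: "commutator (G Mod K) u v \<in> N"
    if N: "N \<lhd> G Mod K" and ne: "N \<noteq> {\<one>\<^bsub>G Mod K\<^esub>}" and u: "u \<in> carrier (G Mod K)" and v: "v \<in> carrier (G Mod K)" for N u v
  proof -
    interpret N: normal N "G Mod K" by (rule N)
    define P where "P = {g \<in> carrier G. K #>\<^bsub>G\<^esub> g \<in> N}"
    have P: "P \<lhd> G" unfolding P_def by (rule K.preimage_normal[OF N])
    have KP: "K \<subseteq> P"
    proof
      fix k assume k: "k \<in> K"
      then have "K #>\<^bsub>G\<^esub> k = K" using K.coset_eq_H_iff[OF K.mem_carrier[OF k]] by simp
      then show "k \<in> P"
        using subgroup.one_closed[OF N.subgroup_axioms] K.mem_carrier[OF k] by (simp add: P_def)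
    qed
    obtain w where w: "w \<in> N" "w \<noteq> K" using ne subgroup.one_closed[OF N.subgroup_axioms] by auto
    then obtain g where "g \<in> carrier G" "w = K #>\<^bsub>G\<^esub> g"
      using N.mem_carrier by (auto simp: carrier_FactGroup)
    then have "g \<in> P" "g \<notin> K" using w K.coset_eq_H_iff by (auto simp: P_def)
    then have "comm_group (G Mod P)" using max[OF P _ KP] by blast
    moreover obtain x y where "x \<in> carrier G" "u = K #>\<^bsub>G\<^esub> x" "y \<in> carrier G" "v = K #>\<^bsub>G\<^esub> y"
      using u v by (auto simp: carrier_FactGroup)
    ultimately show ?thesis
      using normal.comm_group_Mod_iff[OF P] K.coset_commutator by (auto simp: P_def)
  qed
  show ?thesis
  proof (rule Q.minimal_nonabelian_quotient_p_group[OF _ nc min])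
    show "finite (carrier (G Mod K))" using fin by (simp add: carrier_FactGroup)
    show "K #>\<^bsub>G\<^esub> z \<in> group_center (G Mod K)" using K.center_mod_iff[OF zc] z(1) by simp
    show "K #>\<^bsub>G\<^esub> z \<noteq> \<one>\<^bsub>G Mod K\<^esub>" using K.coset_eq_H_iff[OF zc] z(2) by simp
  qed (use that in blast)+
qed

theorem lemma5p1:
  fixes G :: "('a, 'b) monoid_scheme"
  assumes "group G" and "finite (carrier G)"
  shows "(\<forall>K p. maximal_nonabelian_quotient G K \<and>
            normalization_semidom_class.prime (p::nat) \<and> p_group p (G Mod K) \<longrightarrow>
            connected (geometric_realization (prime_divisor_complex G)) \<and>
            trivial_fundamental_group (geometric_realization (prime_divisor_complex G))) \<and>
         (\<not> comm_group G \<and> nilpotent_group G \<longrightarrow>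
            trivial_fundamental_group (geometric_realization (prime_divisor_complex G)))"
proof -
  have cone: "connected (geometric_realization (prime_divisor_complex G)) \<and>
      trivial_fundamental_group (geometric_realization (prime_divisor_complex G))"
    if "maximal_nonabelian_quotient G K" "normalization_semidom_class.prime p" "p_group p (G Mod K)"
    for K and p :: nat
    using cone_realization[OF prime_divisor_complex_cone[OF assms that]] by blast
  moreover have "trivial_fundamental_group (geometric_realization (prime_divisor_complex G))"
    if "\<not> comm_group G" "nilpotent_group G"
  proof -
    obtain K where "maximal_nonabelian_quotient G K"
      using maximal_nonabelian_quotient_exists[OF assms \<open>\<not> comm_group G\<close>] .
    moreover from this obtain p :: nat where "normalization_semidom_class.prime p" "p_group p (G Mod K)"
      using nilpotent_maximal_nonabelian_quotient_p_group[OF assms(2) \<open>nilpotent_group G\<close>] by blast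
    ultimately show ?thesis using cone by blast
  qed
  ultimately show ?thesis by blast
qed

end
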